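(* Let $a\in(0,1)$ and $z>2$ be fixed. Then $$\lim_{n\to\infty}P_n^S\bigl(z;2\lfloor an/2\rfloor\bigr)=-\log(z-1).$$
   Context: For integers $n,j\ge 0$ and $z>0$, let $C_n(z;j)$ be the partition function of pairs of lattice paths in $\mathbb{Z}^2$ with steps $(1,1)$ and $(1,-1)$ such that: the bottom path goes from $(0,0)$ to $(2n,0)$ and never goes below $Y=0$ (a Dyck path); the top path goes from $(0,2)$ to $(2n,2j+2)$; and the two paths have no vertex in common. Each pair is weighted by $z^{v}$, where $v$ is the number of vertices of the bottom path on $Y=0$ other than the origin. For example $C_0(z;0)=1$, $C_1(z;0)=C_1(z;1)=z$, $C_2(z;0)=z+2z^2$. The case $j=0$ describes (after removal of the two end vertices) staircase polygons grafted at both ends to the adsorbing line. For $0<q<n$, the partition function of those pairs counted by $C_n(z;0)$ whose bottom path passes through the vertex at horizontal distance $2q$ from the origin on $Y=0$ (so $q$, like $n$, is measured in half-lengths) is $$Z_n^*(z;q)=\sum_{j=0}^nC_q(z;j)\,C_{n-q}(z;j),$$ and the pressure is $$P_n^S(z;q)=\log\left(1-\frac{Z_n^*(z;q)}{C_n(z;0)}\right).$$ *)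

theory Defs
  imports Complex_Main
begin

definition lattice_step :: "int \<times> int \<Rightarrow> int \<times> int \<Rightarrow> bool" where
  "lattice_step u v \<longleftrightarrow> v = (fst u + 1, snd u + 1) \<or> v = (fst u + 1, snd u - 1)"

text \<open>A path is the list of the vertices it visits.\<close>

definition lattice_path :: "int \<times> int \<Rightarrow> int \<times> int \<Rightarrow> (int \<times> int) list \<Rightarrow> bool" where
  "lattice_path u v p \<longleftrightarrow> p \<noteq> [] \<and> hd p = u \<and> last p = v \<and> successively lattice_step p"

definition path_pairs :: "nat \<Rightarrow> nat \<Rightarrow> ((int \<times> int) list \<times> (int \<times> int) list) set" where
  "path_pairs n j = {(bot, top).
     lattice_path (0, 0) (2 * int n, 0) bot \<and> (\<forall>v \<in> set bot. 0 \<le> snd v) \<and>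
     lattice_path (0, 2) (2 * int n, 2 * int j + 2) top \<and>
     set bot \<inter> set top = {}}"

text \<open>The vertices of a path are pairwise distinct, so the cardinality of a set counts them
  correctly.\<close>

definition contacts :: "(int \<times> int) list \<Rightarrow> nat" where
  "contacts p = card {v \<in> set p. snd v = 0 \<and> v \<noteq> (0, 0)}"

definition C :: "nat \<Rightarrow> real \<Rightarrow> nat \<Rightarrow> real" where
  "C n z j = (\<Sum>(bot, top) \<in> path_pairs n j. z ^ contacts bot)"

text \<open>Lemma \<open>Z_star_eq\<close> below shows that this is the partition function of the pairs whose
  bottom path passes through the vertex \<open>(2 q, 0)\<close>.\<close>

definition Z_star :: "nat \<Rightarrow> real \<Rightarrow> nat \<Rightarrow> real" where
  "Z_star n z q = (\<Sum>j = 0..n. C q z j * C (n - q) z j)"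

definition pressure :: "nat \<Rightarrow> real \<Rightarrow> nat \<Rightarrow> real" where
  "pressure n z q = ln (1 - Z_star n z q / C n z 0)"


subsection \<open>Finiteness, the meaning of \<open>Z_star\<close>, and well-definedness of the logarithm\<close>

lemma lattice_path_iff:
  "lattice_path (0, c) (int m, d) p \<longleftrightarrow>
     length p = Suc m \<and> (\<forall>i\<le>m. fst (p ! i) = int i) \<and> snd (p ! 0) = c \<and> snd (p ! m) = d \<and>
     (\<forall>i<m. snd (p ! Suc i) = snd (p ! i) + 1 \<or> snd (p ! Suc i) = snd (p ! i) - 1)"
  (is "?L \<longleftrightarrow> ?R")
proof
  assume L: ?L
  then have ne: "p \<noteq> []" and h: "p ! 0 = (0, c)" and l: "p ! (length p - 1) = (int m, d)"
    and s: "\<And>i. Suc i < length p \<Longrightarrow> lattice_step (p ! i) (p ! Suc i)"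
    by (auto simp: lattice_path_def hd_conv_nth last_conv_nth successively_conv_nth)
  have f: "fst (p ! i) = int i" if "i < length p" for i
    using that
  proof (induction i)
    case 0
    then show ?case using h by simp
  next
    case (Suc i)
    then show ?case using s[of i] by (auto simp: lattice_step_def)
  qed
  have "int (length p - 1) = int m"
    using f[of "length p - 1"] l ne by simp
  then have len: "length p = Suc m" using ne by (cases p) auto
  show ?R
    using len f h l s by (fastforce simp: lattice_step_def)
next
  assume R: ?R
  then have "p \<noteq> []" by auto
  moreover have "lattice_step (p ! i) (p ! Suc i)" if "Suc i < length p" for i
  proof -
    from that R have "i < m" by simp
    with R have "fst (p ! i) = int i" "fst (p ! Suc i) = int (Suc i)"
      and "snd (p ! Suc i) = snd (p ! i) + 1 \<or> snd (p ! Suc i) = snd (p ! i) - 1" by auto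
    then show ?thesis by (auto simp: lattice_step_def prod_eq_iff)
  qed
  ultimately show ?L using R
    by (auto simp: lattice_path_def hd_conv_nth last_conv_nth successively_conv_nth prod_eq_iff)
qed

lemma path_pairs_iff:
  "(b, t) \<in> path_pairs n j \<longleftrightarrow>
     length b = Suc (2 * n) \<and> length t = Suc (2 * n) \<and>
     (\<forall>i\<le>2*n. fst (b ! i) = int i) \<and> (\<forall>i\<le>2*n. fst (t ! i) = int i) \<and>
     snd (b ! 0) = 0 \<and> snd (b ! (2 * n)) = 0 \<and> snd (t ! 0) = 2 \<and> snd (t ! (2 * n)) = 2 * int j + 2 \<and>
     (\<forall>i<2*n. snd (b ! Suc i) = snd (b ! i) + 1 \<or> snd (b ! Suc i) = snd (b ! i) - 1) \<and>
     (\<forall>i<2*n. snd (t ! Suc i) = snd (t ! i) + 1 \<or> snd (t ! Suc i) = snd (t ! i) - 1) \<and>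
     (\<forall>i\<le>2*n. 0 \<le> snd (b ! i)) \<and> (\<forall>i\<le>2*n. snd (b ! i) \<noteq> snd (t ! i))"
proof -
  have disj: "set b \<inter> set t = {} \<longleftrightarrow> (\<forall>i\<le>2*n. snd (b ! i) \<noteq> snd (t ! i))"
    if "length b = Suc (2 * n)" "length t = Suc (2 * n)"
      "\<forall>i\<le>2*n. fst (b ! i) = int i" "\<forall>i\<le>2*n. fst (t ! i) = int i"
  proof -
    have "set b \<inter> set t = {} \<longleftrightarrow> (\<forall>i\<le>2*n. \<forall>k\<le>2*n. b ! i \<noteq> t ! k)"
      using that(1,2) by (auto simp: set_conv_nth less_Suc_eq_le) metis
    also have "\<dots> \<longleftrightarrow> (\<forall>i\<le>2*n. snd (b ! i) \<noteq> snd (t ! i))"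
    proof (intro iffI allI impI)
      fix i assume "\<forall>i\<le>2*n. \<forall>k\<le>2*n. b ! i \<noteq> t ! k" "i \<le> 2 * n"
      then show "snd (b ! i) \<noteq> snd (t ! i)" using that(3,4) by (metis prod_eqI)
    next
      fix i k assume "\<forall>i\<le>2*n. snd (b ! i) \<noteq> snd (t ! i)" "i \<le> 2 * n" "k \<le> 2 * n"
      then show "b ! i \<noteq> t ! k" using that(3,4) by (metis of_nat_eq_iff)
    qed
    finally show ?thesis .
  qed
  have pos: "(\<forall>v\<in>set b. 0 \<le> snd v) \<longleftrightarrow> (\<forall>i\<le>2*n. 0 \<le> snd (b ! i))" if "length b = Suc (2 * n)"
    using that by (auto simp: all_set_conv_all_nth less_Suc_eq_le)
  have e: "2 * int n = int (2 * n)" by simp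
  show ?thesis
    unfolding path_pairs_def mem_Collect_eq prod.case e lattice_path_iff
    using disj pos by (smt (verit, best))
qed

lemma finite_path_pairs: "finite (path_pairs n j)"
proof -
  let ?V = "{0..2 * int n} \<times> {- 2 * int n..2 * int n + 2}"
  let ?S = "{p. set p \<subseteq> ?V \<and> length p = Suc (2 * n)}"
  have aux: "set p \<subseteq> ?V" if "length p = Suc (2 * n)" "\<forall>i\<le>2*n. fst (p ! i) = int i"
    "0 \<le> snd (p ! 0)" "snd (p ! 0) \<le> 2"
    "\<forall>i<2*n. snd (p ! Suc i) = snd (p ! i) + 1 \<or> snd (p ! Suc i) = snd (p ! i) - 1" for p
  proof -
    have "i \<le> 2 * n \<Longrightarrow> - int i \<le> snd (p ! i) \<and> snd (p ! i) \<le> int i + 2" for i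
    proof (induction i)
      case (Suc i)
      then show ?case using that(5)[rule_format, of i] by auto
    qed (use that in auto)
    with that(1,2) show ?thesis
      by (fastforce simp: in_set_conv_nth less_Suc_eq_le mem_Times_iff)
  qed
  have sub: "path_pairs n j \<subseteq> ?S \<times> ?S"
  proof clarify
    fix b t assume "(b, t) \<in> path_pairs n j"
    note P = this[unfolded path_pairs_iff]
    have "set b \<subseteq> ?V" by (rule aux) (use P in simp_all)
    moreover have "set t \<subseteq> ?V" by (rule aux) (use P in simp_all)
    ultimately show "b \<in> ?S \<and> t \<in> ?S" using P by simp
  qed
  have "finite ?S" by (intro finite_lists_length_eq) auto
  then show ?thesis using finite_subset[OF sub finite_cartesian_product] by blast
qed

lemma contacts_eq:
  assumes "length p = Suc m" "\<forall>i\<le>m. fst (p ! i) = int i"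
  shows "contacts p = card {i \<in> {1..m}. snd (p ! i) = 0}"
proof -
  have "{v \<in> set p. snd v = 0 \<and> v \<noteq> (0, 0)} = (!) p ` {i \<in> {1..m}. snd (p ! i) = 0}"
  proof (intro equalityI subsetI)
    fix v assume v: "v \<in> {v \<in> set p. snd v = 0 \<and> v \<noteq> (0, 0)}"
    then obtain i where i: "i \<le> m" "v = p ! i" using assms(1)
      by (auto simp: in_set_conv_nth less_Suc_eq_le)
    with v assms(2) have "i \<noteq> 0" by (metis (mono_tags, lifting) mem_Collect_eq of_nat_0 prod.collapse)
    with i v show "v \<in> (!) p ` {i \<in> {1..m}. snd (p ! i) = 0}" by auto
  next
    fix v assume "v \<in> (!) p ` {i \<in> {1..m}. snd (p ! i) = 0}"
    then obtain i where i: "1 \<le> i" "i \<le> m" "v = p ! i" "snd v = 0" by auto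
    then have "fst v \<noteq> 0" using assms(2) by auto
    with i assms(1) show "v \<in> {v \<in> set p. snd v = 0 \<and> v \<noteq> (0, 0)}" by auto
  qed
  moreover have "inj_on ((!) p) {i \<in> {1..m}. snd (p ! i) = 0}"
    using assms(2) by (intro inj_onI) (metis (mono_tags, lifting) atLeastAtMost_iff mem_Collect_eq of_nat_eq_iff)
  ultimately show ?thesis by (simp add: contacts_def card_image)
qed

lemma top_height:
  assumes "(b, t) \<in> path_pairs n j" "i \<le> 2 * n"
  shows "even (snd (b ! i) + int i)" "even (snd (t ! i) + int i)"
    "snd (b ! i) + 2 \<le> snd (t ! i)" "snd (t ! i) \<le> int i + 2"
proof -
  have "even (snd (b ! i) + int i) \<and> even (snd (t ! i) + int i) \<and>
    snd (b ! i) + 2 \<le> snd (t ! i) \<and> snd (t ! i) \<le> int i + 2"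
    using assms(2)
  proof (induction i)
    case 0
    then show ?case using assms(1) by (simp add: path_pairs_iff)
  next
    case (Suc i)
    then have i: "i < 2 * n" by simp
    from assms(1) i have
      s: "snd (b ! Suc i) = snd (b ! i) + 1 \<or> snd (b ! Suc i) = snd (b ! i) - 1"
      "snd (t ! Suc i) = snd (t ! i) + 1 \<or> snd (t ! Suc i) = snd (t ! i) - 1"
      "snd (b ! Suc i) \<noteq> snd (t ! Suc i)"
      by (auto simp: path_pairs_iff)
    have ih: "even (snd (b ! i) + int i)" "even (snd (t ! i) + int i)"
      "snd (b ! i) + 2 \<le> snd (t ! i)" "snd (t ! i) \<le> int i + 2" using Suc i by auto
    have e: "even (snd (b ! Suc i) + int (Suc i))" "even (snd (t ! Suc i) + int (Suc i))"
      using s(1,2) ih(1,2) by auto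
    have "snd (b ! Suc i) \<le> snd (t ! Suc i)" using s ih(3) by auto
    moreover have "even (snd (t ! Suc i) - snd (b ! Suc i))" using e by presburger
    ultimately have "snd (b ! Suc i) + 2 \<le> snd (t ! Suc i)" using s(3) by presburger
    with e s ih show ?case by auto
  qed
  then show "even (snd (b ! i) + int i)" "even (snd (t ! i) + int i)"
    "snd (b ! i) + 2 \<le> snd (t ! i)" "snd (t ! i) \<le> int i + 2" by auto
qed

definition mk_path :: "nat \<Rightarrow> (nat \<Rightarrow> int) \<Rightarrow> (int \<times> int) list" where
  "mk_path m h = map (\<lambda>i. (int i, h i)) [0..<Suc m]"

lemma mk_path_simps [simp]:
  "length (mk_path m h) = Suc m"
  "i \<le> m \<Longrightarrow> mk_path m h ! i = (int i, h i)"
  by (auto simp: mk_path_def nth_append simp del: upt_Suc)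

lemma mk_path_eqI:
  assumes "length p = Suc m" "\<And>i. i \<le> m \<Longrightarrow> fst (p ! i) = int i" "\<And>i. i \<le> m \<Longrightarrow> h i = snd (p ! i)"
  shows "mk_path m h = p"
  using assms by (intro nth_equalityI) (auto simp: less_Suc_eq_le prod_eq_iff)

definition left_part :: "nat \<Rightarrow> (int \<times> int) list \<Rightarrow> (int \<times> int) list" where
  "left_part q p = mk_path (2 * q) (\<lambda>i. snd (p ! i))"

definition right_part :: "nat \<Rightarrow> nat \<Rightarrow> (int \<times> int) list \<Rightarrow> (int \<times> int) list" where
  "right_part n q p = mk_path (2 * (n - q)) (\<lambda>i. snd (p ! (2 * n - i)))"

definition glue :: "nat \<Rightarrow> nat \<Rightarrow> (int \<times> int) list \<Rightarrow> (int \<times> int) list \<Rightarrow> (int \<times> int) list" where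
  "glue n q p p' = mk_path (2 * n) (\<lambda>i. if i \<le> 2 * q then snd (p ! i) else snd (p' ! (2 * n - i)))"

lemma glue_in:
  assumes q: "q \<le> n" and 1: "(b, t) \<in> path_pairs q j" and 2: "(b', t') \<in> path_pairs (n - q) j"
  shows "(glue n q b b', glue n q t t') \<in> path_pairs n 0"
    and "left_part q (glue n q b b') = b" "left_part q (glue n q t t') = t"
    and "right_part n q (glue n q b b') = b'" "right_part n q (glue n q t t') = t'"
    and "contacts (glue n q b b') = contacts b + contacts b'"
    and "snd (glue n q b b' ! (2 * q)) = 0" "snd (glue n q t t' ! (2 * q)) = 2 * int j + 2"
proof -
  have step: "snd (glue n q p p' ! Suc i) = snd (glue n q p p' ! i) + 1 \<or>
      snd (glue n q p p' ! Suc i) = snd (glue n q p p' ! i) - 1"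
    if a: "\<forall>i<2*q. snd (p ! Suc i) = snd (p ! i) + 1 \<or> snd (p ! Suc i) = snd (p ! i) - 1"
      "\<forall>i<2*(n-q). snd (p' ! Suc i) = snd (p' ! i) + 1 \<or> snd (p' ! Suc i) = snd (p' ! i) - 1"
      "snd (p ! (2*q)) = snd (p' ! (2 * (n-q)))" "i < 2 * n" for p p' i
  proof (cases "i < 2 * q")
    case True
    then show ?thesis using a(1) q a(4) by (auto simp: glue_def)
  next
    case False
    have v: "snd (glue n q p p' ! i) = snd (p' ! (2 * n - i))"
      "snd (glue n q p p' ! Suc i) = snd (p' ! (2 * n - Suc i))"
      using False a(3,4) by (auto simp: glue_def diff_mult_distrib2 dest!: le_antisym)
    have "Suc (2 * n - Suc i) = 2 * n - i" "2 * n - Suc i < 2 * (n - q)" using False a(4) by auto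
    then show ?thesis using a(2)[rule_format, of "2 * n - Suc i"] v by auto
  qed
  note P = 1[unfolded path_pairs_iff] 2[unfolded path_pairs_iff]
  have G: "length (glue n q p p') = Suc (2 * n)" "i \<le> 2 * n \<Longrightarrow> fst (glue n q p p' ! i) = int i"
    for p p' i by (auto simp: glue_def)
  have val: "snd (glue n q p p' ! i) = (if i \<le> 2 * q then snd (p ! i) else snd (p' ! (2 * n - i)))"
    if "i \<le> 2 * n" for p p' i using that by (auto simp: glue_def)
  have val2: "snd (glue n q p p' ! (2 * n - i)) = snd (p' ! i)"
    if "i \<le> 2 * (n - q)" "snd (p ! (2*q)) = snd (p' ! (2 * (n-q)))" for p p' i
  proof (cases "i = 2 * (n - q)")
    case True
    then have "2 * n - i = 2 * q" using q by auto
    then show ?thesis using val[of "2 * q" p p'] q that True by simp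
  next
    case False
    then have "\<not> 2 * n - i \<le> 2 * q" "2 * n - (2 * n - i) = i" using that q by auto
    then show ?thesis using val[of "2 * n - i" p p'] by simp
  qed
  have jb: "snd (b ! (2*q)) = snd (b' ! (2 * (n-q)))" "snd (t ! (2*q)) = snd (t' ! (2 * (n-q)))"
    using P by auto
  have g0: "snd (glue n q p p' ! 0) = snd (p ! 0)" for p p' by (simp add: glue_def)
  have gn: "snd (glue n q b b' ! (2*n)) = snd (b' ! 0)" "snd (glue n q t t' ! (2*n)) = snd (t' ! 0)"
    using val2[of 0] jb by auto
  have pos: "0 \<le> snd (glue n q b b' ! i)" if "i \<le> 2 * n" for i
  proof (cases "i \<le> 2 * q")
    case True
    then show ?thesis using P(1) that by (simp add: val)
  next
    case False
    then have "2 * n - i \<le> 2 * (n - q)" by auto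
    then show ?thesis using False P(2) that by (simp add: val)
  qed
  have dis: "snd (glue n q b b' ! i) \<noteq> snd (glue n q t t' ! i)" if "i \<le> 2 * n" for i
  proof (cases "i \<le> 2 * q")
    case True
    then show ?thesis using P(1) that by (simp add: val)
  next
    case False
    then have "2 * n - i \<le> 2 * (n - q)" by auto
    then show ?thesis using False P(2) that by (simp add: val)
  qed
  have sb: "\<forall>i<2*n. snd (glue n q b b' ! Suc i) = snd (glue n q b b' ! i) + 1 \<or>
      snd (glue n q b b' ! Suc i) = snd (glue n q b b' ! i) - 1"
    using step[of b b'] P jb by blast
  have st: "\<forall>i<2*n. snd (glue n q t t' ! Suc i) = snd (glue n q t t' ! i) + 1 \<or>
      snd (glue n q t t' ! Suc i) = snd (glue n q t t' ! i) - 1"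
    using step[of t t'] P jb by blast
  show "(glue n q b b', glue n q t t') \<in> path_pairs n 0"
    unfolding path_pairs_iff
    using G sb st pos dis gn P g0 by auto
  show "left_part q (glue n q b b') = b" "left_part q (glue n q t t') = t"
    unfolding left_part_def using P q by (auto intro!: mk_path_eqI simp: val)
  show "right_part n q (glue n q b b') = b'" "right_part n q (glue n q t t') = t'"
    unfolding right_part_def using P jb by (auto intro!: mk_path_eqI simp: val2)
  show "snd (glue n q b b' ! (2 * q)) = 0" "snd (glue n q t t' ! (2 * q)) = 2 * int j + 2"
    using P q by (auto simp: val)
  have "{i \<in> {1..2*n}. snd (glue n q b b' ! i) = 0} =
     {i \<in> {1..2*q}. snd (b ! i) = 0} \<union> (\<lambda>i. Suc (2 * n) - Suc i) ` {i \<in> {0..<2*(n-q)}. snd (b' ! i) = 0}"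
    (is "?L = ?A \<union> ?B")
  proof (intro equalityI subsetI)
    fix i assume i: "i \<in> ?L"
    show "i \<in> ?A \<union> ?B"
    proof (cases "i \<le> 2 * q")
      case False
      then have "i = 2 * n - (2 * n - i)" "2 * n - i \<in> {i \<in> {0..<2*(n-q)}. snd (b' ! i) = 0}"
        using i by (auto simp: val)
      then show ?thesis by (auto simp: image_iff)
    qed (use i in \<open>auto simp: val\<close>)
  qed (use q jb in \<open>auto simp: val val2\<close>)
  moreover have "?A \<inter> ?B = {}" by auto
  moreover have "card ?B = card {i \<in> {0..<2*(n-q)}. snd (b' ! i) = 0}"
    by (intro card_image inj_onI) auto
  moreover have "card {i \<in> {0..<2*(n-q)}. snd (b' ! i) = 0} = card {i \<in> {1..2*(n-q)}. snd (b' ! i) = 0}"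
  proof (cases "n = q")
    case False
    then have "{i \<in> {0..<2*(n-q)}. snd (b' ! i) = 0} = insert 0 {i \<in> {1..<2*(n-q)}. snd (b' ! i) = 0}"
      "{i \<in> {1..2*(n-q)}. snd (b' ! i) = 0} = insert (2*(n-q)) {i \<in> {1..<2*(n-q)}. snd (b' ! i) = 0}"
      using P(2) q by (auto simp: Suc_le_eq order_le_less)
    moreover have "finite {i \<in> {1..<2*(n-q)}. snd (b' ! i) = 0}" by simp
    ultimately show ?thesis by (simp only: card_insert_if mem_Collect_eq atLeastLessThan_iff) simp
  qed auto
  ultimately have "card ?L = card ?A + card {i \<in> {1..2*(n-q)}. snd (b' ! i) = 0}"
    by (simp add: card_Un_disjoint)
  then show "contacts (glue n q b b') = contacts b + contacts b'"
    using contacts_eq[of b "2*q"] contacts_eq[of b' "2*(n-q)"] contacts_eq[of "glue n q b b'" "2*n"] P G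
    by simp
qed

lemma parts_in:
  assumes q: "q \<le> n" and bt: "(b, t) \<in> path_pairs n 0" and z: "snd (b ! (2 * q)) = 0"
    and j: "snd (t ! (2 * q)) = 2 * int j + 2"
  shows "(left_part q b, left_part q t) \<in> path_pairs q j"
    "(right_part n q b, right_part n q t) \<in> path_pairs (n - q) j"
    "glue n q (left_part q b) (right_part n q b) = b"
    "glue n q (left_part q t) (right_part n q t) = t"
proof -
  note P = bt[unfolded path_pairs_iff]
  show "(left_part q b, left_part q t) \<in> path_pairs q j"
    using P q z j by (auto simp: path_pairs_iff left_part_def)
  have step: "snd (p ! (2 * n - Suc i)) = snd (p ! (2 * n - i)) + 1 \<or>
      snd (p ! (2 * n - Suc i)) = snd (p ! (2 * n - i)) - 1"
    if "\<forall>i<2*n. snd (p ! Suc i) = snd (p ! i) + 1 \<or> snd (p ! Suc i) = snd (p ! i) - 1"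
      "i < 2 * (n - q)" for p :: "(int \<times> int) list" and i
  proof -
    have "Suc (2 * n - Suc i) = 2 * n - i" "2 * n - Suc i < 2 * n" using that(2) by auto
    then show ?thesis using that(1)[rule_format, of "2 * n - Suc i"] by auto
  qed
  have e: "2 * n - 2 * (n - q) = 2 * q" using q by auto
  show "(right_part n q b, right_part n q t) \<in> path_pairs (n - q) j"
    using P z j e step[of b] step[of t] by (simp add: path_pairs_iff right_part_def)
  show "glue n q (left_part q b) (right_part n q b) = b"
    "glue n q (left_part q t) (right_part n q t) = t"
    unfolding glue_def using P
    by (auto intro!: mk_path_eqI simp: left_part_def right_part_def)
qed

lemma path_pairs_passes_iff:
  assumes "(b, t) \<in> path_pairs n j" "q \<le> n"
  shows "(2 * int q, 0) \<in> set b \<longleftrightarrow> snd (b ! (2 * q)) = 0"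
proof
  assume "(2 * int q, 0) \<in> set b"
  then obtain i where i: "i \<le> 2 * n" "b ! i = (2 * int q, 0)"
    using assms by (auto simp: in_set_conv_nth path_pairs_iff less_Suc_eq_le)
  then have "int i = 2 * int q" using assms by (auto simp: path_pairs_iff)
  then have "i = 2 * q" by linarith
  with i show "snd (b ! (2 * q)) = 0" by simp
next
  assume "snd (b ! (2 * q)) = 0"
  moreover have "fst (b ! (2 * q)) = 2 * int q" "2 * q < length b"
    using assms by (auto simp: path_pairs_iff)
  ultimately show "(2 * int q, 0) \<in> set b" by (metis nth_mem prod.collapse)
qed

lemma Z_star_eq:
  assumes q: "q \<le> n"
  shows "Z_star n z q =
    (\<Sum>(bot, top) \<in> {(bot, top) \<in> path_pairs n 0. (2 * int q, 0) \<in> set bot}. z ^ contacts bot)"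
proof -
  let ?A = "{(b, t) \<in> path_pairs n 0. (2 * int q, 0) \<in> set b}"
  let ?S = "Sigma {0..n} (\<lambda>j. path_pairs q j \<times> path_pairs (n - q) j)"
  let ?jj = "\<lambda>t :: (int \<times> int) list. nat ((snd (t ! (2 * q)) - 2) div 2)"
  define I where "I = (\<lambda>(b, t). (?jj t, (left_part q b, left_part q t), (right_part n q b, right_part n q t)))"
  define J where "J = (\<lambda>(j :: nat, (b, t), (b', t')). (glue n q b b', glue n q t t'))"
  have "Z_star n z q = (\<Sum>j = 0..n. \<Sum>(x, y) \<in> path_pairs q j \<times> path_pairs (n - q) j.
      z ^ contacts (fst x) * z ^ contacts (fst y))"
    by (simp add: Z_star_def C_def sum_product sum.cartesian_product case_prod_beta)
  also have "\<dots> = (\<Sum>(j, x, y) \<in> ?S. z ^ contacts (fst x) * z ^ contacts (fst y))"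
    by (subst sum.Sigma) (auto simp: finite_path_pairs case_prod_beta)
  also have "\<dots> = (\<Sum>(b, t) \<in> ?A. z ^ contacts b)"
  proof (rule sum.reindex_bij_witness
      [where i = I and j = J])
    fix s assume s: "s \<in> ?S"
    then obtain j b t b' t' where [simp]: "s = (j, (b, t), (b', t'))" by (metis prod.collapse)
    from s have "(b, t) \<in> path_pairs q j" "(b', t') \<in> path_pairs (n - q) j" by auto
    note g = glue_in[OF q this]
    show "I (J s) = s"
      using g by (simp add: I_def J_def)
    show "J s \<in> ?A"
      using g path_pairs_passes_iff[OF g(1) q] by (simp add: J_def)
    show "(case J s of (b, t) \<Rightarrow> z ^ contacts b) = (case s of (j, x, y) \<Rightarrow> z ^ contacts (fst x) * z ^ contacts (fst y))"
      using g by (simp add: J_def power_add)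
  next
    fix s assume s: "s \<in> ?A"
    then obtain b t where [simp]: "s = (b, t)" and bt: "(b, t) \<in> path_pairs n 0"
      and "(2 * int q, 0) \<in> set b" by auto
    then have 0: "snd (b ! (2 * q)) = 0" using path_pairs_passes_iff q by blast
    have "2 * q \<le> 2 * n" using q by simp
    note h = top_height[OF bt this]
    have j: "snd (t ! (2 * q)) = 2 * int (?jj t) + 2" using h(2,3) 0 by auto
    have "?jj t \<le> n" using h(4) q by auto
    note p = parts_in[OF q bt 0 j]
    show "J (I s) = s"
      using p by (simp add: I_def J_def)
    show "I s \<in> ?S"
      using p \<open>?jj t \<le> n\<close> by (simp add: I_def)
  qed
  finally show ?thesis .
qed

text \<open>For \<open>0 < q < n\<close> the argument of the logarithm in \<open>pressure\<close> is positive, so the value of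
  \<open>ln\<close> outside \<open>(0, \<infinity>)\<close> never matters.\<close>

lemma Z_star_less:
  assumes "0 < q" "q < n" "0 < z"
  shows "Z_star n z q < C n z 0"
proof -
  let ?h = "\<lambda>i. if i \<le> n then int i else 2 * int n - int i"
  let ?x = "(mk_path (2 * n) ?h, mk_path (2 * n) (\<lambda>i. ?h i + 2))"
  have x: "?x \<in> path_pairs n 0" by (auto simp: path_pairs_iff)
  have "(2 * int q, 0) \<notin> set (fst ?x)"
    using path_pairs_passes_iff[of "fst ?x" "snd ?x" n 0 q] x assms by auto
  with x have "?x \<in> path_pairs n 0 - {(bot, top) \<in> path_pairs n 0. (2 * int q, 0) \<in> set bot}" by auto
  then show ?thesis unfolding Z_star_eq[OF less_imp_le[OF assms(2)]] C_def
    by (intro sum_strict_mono2[OF finite_path_pairs, of _ _ _ ?x]) (use assms in auto)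
qed


end

theory Submission
  imports Defs "HOL-Real_Asymp.Real_Asymp"
begin

text \<open>A Karlin--McGregor determinant expresses \<open>C n z j\<close> through single walks at the even heights
  \<open>2 k\<close> of the half line, with a weighted wall. For \<open>z > 2\<close> the two-step transfer operator has a
  ground state \<open>p ^ k\<close> with \<open>p = 1 / (z - 1)\<close> and eigenvalue \<open>z\<^sup>2 / (z - 1) > 4\<close>, while it grows like
  \<open>4 ^ n\<close> on the orthogonal complement. Up to exponentially small relative errors, the determinant
  is therefore the wedge product of the ground state, which the bottom path occupies, and the walk
  \<open>w n\<close> that starts at the component of the top path orthogonal to it. The wedge product is
  proportional to \<open>G n k = w n k - p ^ k * w n 0\<close>. Symmetry of the transfer operator and
  orthogonality give, for \<open>a + b = n\<close>, that \<open>\<Sum>k\<ge>1. G a k * G b k\<close> equals \<open>G n 1\<close> up to a multiple of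
  \<open>w a 0 * w b 0\<close>, a product of two Catalan numbers and so negligible when \<open>a\<close> and \<open>b\<close> are both
  proportional to \<open>n\<close>. Hence \<open>Z_star n z q / C n z 0\<close> tends to the weight \<open>1 - p\<close> of the ground state
  at the wall.\<close>

section \<open>The determinant formula\<close>

definition path_pairs_to ::
    "nat \<Rightarrow> int \<Rightarrow> int \<Rightarrow> ((int \<times> int) list \<times> (int \<times> int) list) set" where
  "path_pairs_to m x y = {(bot, top).
     lattice_path (0, 0) (int m, x) bot \<and> (\<forall>v \<in> set bot. 0 \<le> snd v) \<and>
     lattice_path (0, 2) (int m, y) top \<and> set bot \<inter> set top = {}}"

definition pair_weight :: "real \<Rightarrow> nat \<Rightarrow> int \<Rightarrow> int \<Rightarrow> real" where
  "pair_weight z m x y = (\<Sum>(bot, top) \<in> path_pairs_to m x y. z ^ contacts bot)"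

lemma C_eq_pair_weight: "C n z j = pair_weight z (2 * n) 0 (2 * int j + 2)"
  by (simp add: C_def pair_weight_def path_pairs_def path_pairs_to_def)

lemma lattice_path_0: "lattice_path (0, c) (0, d) p \<longleftrightarrow> p = [(0, c)] \<and> d = c"
  using lattice_path_iff[of c 0 d p] by (cases p) (auto simp: prod_eq_iff)

lemma lattice_path_Suc:
  "lattice_path (0, c) (int (Suc m), d) p \<longleftrightarrow>
     (\<exists>p' d'. p = p' @ [(int (Suc m), d)] \<and> d' \<in> {d - 1, d + 1} \<and> lattice_path (0, c) (int m, d') p')"
proof
  assume L: "lattice_path (0, c) (int (Suc m), d) p"
  then have "length p = Suc (Suc m)" using lattice_path_iff by blast
  then obtain p' v where p: "p = p' @ [v]" and ne: "p' \<noteq> []"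
    by (metis Zero_not_Suc add_diff_cancel_right' append_butlast_last_id diff_Suc_1 length_butlast list.size(3))
  have "v = (int (Suc m), d)" "hd p' = (0, c)" "successively lattice_step p'"
    "lattice_step (last p') v"
    using L p ne by (auto simp: lattice_path_def successively_append_iff)
  then show "\<exists>p' d'. p = p' @ [(int (Suc m), d)] \<and> d' \<in> {d - 1, d + 1} \<and> lattice_path (0, c) (int m, d') p'"
    using p ne by (intro exI[of _ p'] exI[of _ "snd (last p')"])
      (auto simp: lattice_path_def lattice_step_def prod_eq_iff)
next
  assume "\<exists>p' d'. p = p' @ [(int (Suc m), d)] \<and> d' \<in> {d - 1, d + 1} \<and> lattice_path (0, c) (int m, d') p'"
  then show "lattice_path (0, c) (int (Suc m), d) p"
    by (auto simp: lattice_path_def lattice_step_def successively_append_iff)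
qed

lemma lattice_path_last: "lattice_path u v p \<Longrightarrow> last p = v"
  by (simp add: lattice_path_def)

lemma lattice_path_last_in: "lattice_path u v p \<Longrightarrow> v \<in> set p"
  by (auto simp: lattice_path_def)

lemma lattice_path_fst_le: "lattice_path (0, c) (int m, d) p \<Longrightarrow> v \<in> set p \<Longrightarrow> fst v \<le> int m"
  by (auto simp: lattice_path_iff in_set_conv_nth less_Suc_eq_le)

lemma path_pairs_to_0:
  "path_pairs_to 0 x y = (if x = 0 \<and> y = 2 then {([(0, 0)], [(0, 2)])} else {})"
  by (auto simp: path_pairs_to_def lattice_path_0)

text \<open>The two boundary conditions of the recursion: the wall, and the diagonal, where the
  paths would share their last vertex.\<close>

lemma path_pairs_to_empty: "x < 0 \<or> x = y \<Longrightarrow> path_pairs_to m x y = {}"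
  by (auto simp: path_pairs_to_def disjoint_iff dest!: lattice_path_last_in) force

text \<open>The new vertices have abscissa \<open>Suc m\<close>, which no earlier vertex reaches, so
  the two hypotheses exclude every new collision and every new visit below the wall.\<close>

lemma path_pairs_to_Suc:
  assumes "0 \<le> x" "x \<noteq> y"
  shows "path_pairs_to (Suc m) x y =
    (\<lambda>(b, t). (b @ [(int (Suc m), x)], t @ [(int (Suc m), y)])) `
      (\<Union>(x', y') \<in> {x - 1, x + 1} \<times> {y - 1, y + 1}. path_pairs_to m x' y')"
  (is "_ = ?f ` ?U")
proof (intro equalityI subsetI)
  fix s assume s: "s \<in> path_pairs_to (Suc m) x y"
  obtain b t where [simp]: "s = (b, t)" by fastforce
  from s obtain b' t' x' y' where "b = b' @ [(int (Suc m), x)]" "t = t' @ [(int (Suc m), y)]"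
    "x' \<in> {x - 1, x + 1}" "y' \<in> {y - 1, y + 1}"
    "lattice_path (0, 0) (int m, x') b'" "lattice_path (0, 2) (int m, y') t'"
    unfolding path_pairs_to_def mem_Collect_eq \<open>s = (b, t)\<close> prod.case lattice_path_Suc by metis
  with s show "s \<in> ?f ` ?U"
    by (auto simp: path_pairs_to_def intro!: image_eqI[of _ _ "(b', t')"])
next
  fix s assume "s \<in> ?f ` ?U"
  then obtain b t x' y' where s: "s = (b @ [(int (Suc m), x)], t @ [(int (Suc m), y)])"
    and xy: "x' \<in> {x - 1, x + 1}" "y' \<in> {y - 1, y + 1}" and bt: "(b, t) \<in> path_pairs_to m x' y'"
    by (auto split: prod.splits)
  have "\<And>c. (int (Suc m), c) \<notin> set b" "\<And>c. (int (Suc m), c) \<notin> set t"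
    using bt lattice_path_fst_le by (fastforce simp: path_pairs_to_def)+
  then show "s \<in> path_pairs_to (Suc m) x y"
    using bt s xy assms unfolding path_pairs_to_def mem_Collect_eq s prod.case lattice_path_Suc
    by auto
qed

lemma finite_path_pairs_to: "finite (path_pairs_to m x y)"
proof (induction m arbitrary: x y)
  case (Suc m)
  then show ?case
    using path_pairs_to_empty[of x y "Suc m"] path_pairs_to_Suc[of x y m]
    by (cases "0 \<le> x \<and> x \<noteq> y") auto
qed (simp add: path_pairs_to_0)

lemma contacts_snoc:
  assumes "lattice_path (0, c) (int m, d) b"
  shows "contacts (b @ [(int (Suc m), x)]) = contacts b + of_bool (x = 0)"
proof -
  let ?S = "{v \<in> set b. snd v = 0 \<and> v \<noteq> (0, 0)}"
  have new: "(int (Suc m), x) \<notin> ?S" using assms lattice_path_fst_le by fastforce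
  have snoc: "{v \<in> set (b @ [(int (Suc m), x)]). snd v = 0 \<and> v \<noteq> (0, 0)} =
    (if x = 0 then insert (int (Suc m), x) ?S else ?S)"
    by auto
  have "finite ?S" by simp
  then show ?thesis
    unfolding contacts_def snoc using card_insert_disjoint[OF _ new] by (cases "x = 0") simp_all
qed

lemma pair_weight_Suc:
  assumes "0 \<le> x" "x \<noteq> y"
  shows "pair_weight z (Suc m) x y = (if x = 0 then z else 1) *
    (pair_weight z m (x - 1) (y - 1) + pair_weight z m (x - 1) (y + 1) +
     pair_weight z m (x + 1) (y - 1) + pair_weight z m (x + 1) (y + 1))"
proof -
  let ?f = "\<lambda>(b, t). (b @ [(int (Suc m), x)], t @ [(int (Suc m), y)])"
  let ?I = "{x - 1, x + 1} \<times> {y - 1, y + 1}"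
  let ?w = "if x = 0 then z else 1"
  have "pair_weight z (Suc m) x y =
    (\<Sum>s \<in> (\<Union>i\<in>?I. path_pairs_to m (fst i) (snd i)). z ^ contacts (fst (?f s)))"
    unfolding pair_weight_def path_pairs_to_Suc[OF assms]
    by (subst sum.reindex) (auto simp: inj_on_def case_prod_beta)
  also have "\<dots> = (\<Sum>i\<in>?I. \<Sum>s\<in>path_pairs_to m (fst i) (snd i). z ^ contacts (fst (?f s)))"
  proof (rule sum.UNION_disjoint)
    show "\<forall>i\<in>?I. finite (path_pairs_to m (fst i) (snd i))"
      by (simp add: finite_path_pairs_to)
    \<comment> \<open>The end heights can be read off the last vertices, so the four sets in the
      union are disjoint.\<close>
    have end_eq: "i = (snd (last (fst s)), snd (last (snd s)))"
      if "s \<in> path_pairs_to m (fst i) (snd i)" for i s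
      using that by (auto simp: path_pairs_to_def dest!: lattice_path_last)
    have "i = i'" if "s \<in> path_pairs_to m (fst i) (snd i)" "s \<in> path_pairs_to m (fst i') (snd i')"
      for i i' s using end_eq[OF that(1)] end_eq[OF that(2)] by simp
    then show "\<forall>i\<in>?I. \<forall>i'\<in>?I. i \<noteq> i' \<longrightarrow>
        path_pairs_to m (fst i) (snd i) \<inter> path_pairs_to m (fst i') (snd i') = {}"
      by blast
  qed simp
  also have "\<dots> = (\<Sum>i\<in>?I. \<Sum>s\<in>path_pairs_to m (fst i) (snd i). ?w * z ^ contacts (fst s))"
    by (intro sum.cong refl) (auto simp: path_pairs_to_def contacts_snoc simp del: of_nat_Suc)
  also have "\<dots> = (\<Sum>i\<in>?I. ?w * pair_weight z m (fst i) (snd i))"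
    by (simp add: pair_weight_def sum_distrib_left case_prod_beta)
  also have "\<dots> = (\<Sum>x'\<in>{x - 1, x + 1}. \<Sum>y'\<in>{y - 1, y + 1}. ?w * pair_weight z m x' y')"
    by (simp add: sum.cartesian_product case_prod_beta)
  finally show ?thesis by (simp add: algebra_simps)
qed

text \<open>Transfer operator of one path. The wall factor is charged on arrival at height
  \<open>0\<close>, so the origin is free. Both walks of the determinant carry it, but the top path
  of a pair stays above the bottom path and is never charged.\<close>

definition height_step :: "real \<Rightarrow> (int \<Rightarrow> real) \<Rightarrow> int \<Rightarrow> real" where
  "height_step z g h = (if h < 0 then 0 else if h = 0 then z * g 1 else g (h - 1) + g (h + 1))"

text \<open>The Karlin--McGregor determinant: it vanishes on the diagonal and obeys the recursion of two
  independent paths, hence that of the non-intersecting pairs.\<close>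

lemma pair_weight_eq_det:
  fixes z :: real
  assumes "0 \<le> x" "x < y" "even (x + y)"
  defines "U \<equiv> \<lambda>m. (height_step z ^^ m) (\<lambda>h. of_bool (h = 0))"
    and "V \<equiv> \<lambda>m. (height_step z ^^ m) (\<lambda>h. of_bool (h = 2))"
  shows "pair_weight z m x y = U m x * V m y - U m y * V m x"
  using assms(1-3)
proof (induction m arbitrary: x y)
  case 0
  have "{v \<in> set [(0, 0)]. snd v = 0 \<and> v \<noteq> (0, 0)} = ({} :: (int \<times> int) set)" by auto
  then have "contacts [(0, 0)] = 0" by (simp only: contacts_def card.empty)
  with 0 show ?case by (auto simp: pair_weight_def path_pairs_to_0 U_def V_def)
next
  case (Suc m)
  \<comment> \<open>By parity the end heights differ by at least two, so their predecessors can meet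
    but not cross; when they meet, both sides vanish.\<close>
  have y: "x + 2 \<le> y" using Suc.prems by presburger
  have diag: "pair_weight z m x' x' = 0" for x' by (simp add: pair_weight_def path_pairs_to_empty)
  have neg: "pair_weight z m (- 1) y' = 0" for y' by (simp add: pair_weight_def path_pairs_to_empty)
  have IH: "pair_weight z m x' y' = U m x' * V m y' - U m y' * V m x'"
    if "0 \<le> x'" "x' \<le> y'" "even (x' + y')" for x' y'
    using Suc.IH[of x' y'] that diag by (cases "x' = y'") auto
  have st: "U (Suc m) = height_step z (U m)" "V (Suc m) = height_step z (V m)"
    by (simp_all add: U_def V_def)
  show ?case
  \<comment> \<open>At the wall the two predecessors with bottom height \<open>- 1\<close>
    contribute nothing, and the factor \<open>z\<close> comes from \<open>U\<close> and
    \<open>V\<close> at height \<open>0\<close>.\<close>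
  proof (cases "x = 0")
    case True
    then show ?thesis
      using y Suc.prems
      by (simp add: pair_weight_Suc neg IH st height_step_def) (simp add: algebra_simps)
  next
    case False
    then show ?thesis
      using y Suc.prems
      by (simp add: pair_weight_Suc IH st height_step_def) (simp add: algebra_simps)
  qed
qed

section \<open>Two steps at once on even heights, where index \<open>k\<close> stands for height
  \<open>2 * k\<close>\<close>

definition double_step :: "real \<Rightarrow> (nat \<Rightarrow> real) \<Rightarrow> nat \<Rightarrow> real" where
  "double_step z g k = (case k of 0 \<Rightarrow> z * (g 0 + g 1) | Suc i \<Rightarrow> g i + 2 * g (Suc i) + g (Suc (Suc i)))"

lemma double_step_simps [simp]:
  "double_step z g 0 = z * (g 0 + g 1)"
  "double_step z g (Suc k) = g k + 2 * g (Suc k) + g (Suc (Suc k))"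
  by (simp_all add: double_step_def)

lemma height_step_even:
  "(height_step z ^^ (2 * n)) f (2 * int k) = (double_step z ^^ n) (\<lambda>k. f (2 * int k)) k"
proof (induction n arbitrary: k)
  case (Suc n)
  show ?case
  proof (cases k)
    case 0
    then show ?thesis using Suc.IH[of 0] Suc.IH[of 1] by (simp add: height_step_def)
  next
    case (Suc i)
    have "(height_step z ^^ (2 * Suc n)) f (2 * int k) =
      (let g = (height_step z ^^ (2 * n)) f in g (2 * int i) + 2 * g (2 * int (Suc i)) + g (2 * int (Suc (Suc i))))"
      using Suc by (simp add: height_step_def Let_def algebra_simps)
    then show ?thesis using Suc by (simp add: Suc.IH Let_def del: of_nat_Suc)
  qed
qed simp

definition contact_kernel :: "real \<Rightarrow> nat \<Rightarrow> nat \<Rightarrow> nat \<Rightarrow> real" where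
  "contact_kernel z i n = (double_step z ^^ n) (\<lambda>k. of_bool (k = i))"

lemma contact_kernel_simps [simp]:
  "contact_kernel z i 0 k = of_bool (k = i)"
  "contact_kernel z i (Suc n) = double_step z (contact_kernel z i n)"
  by (simp_all add: contact_kernel_def)

lemma C_eq_det:
  "C n z j = contact_kernel z 0 n 0 * contact_kernel z 1 n (Suc j) -
     contact_kernel z 0 n (Suc j) * contact_kernel z 1 n 0"
proof -
  have U: "(height_step z ^^ (2 * n)) (\<lambda>h. of_bool (h = 0)) (2 * int k) = contact_kernel z 0 n k" for k
    by (simp add: height_step_even contact_kernel_def)
  have V: "(height_step z ^^ (2 * n)) (\<lambda>h. of_bool (h = 2)) (2 * int k) = contact_kernel z 1 n k" for k
    by (simp add: height_step_even contact_kernel_def)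
  have "C n z j = pair_weight z (2 * n) (2 * int 0) (2 * int (Suc j))"
    by (simp add: C_eq_pair_weight algebra_simps)
  also have "\<dots> = contact_kernel z 0 n 0 * contact_kernel z 1 n (Suc j) -
     contact_kernel z 0 n (Suc j) * contact_kernel z 1 n 0"
    by (subst pair_weight_eq_det) (simp_all only: U V, simp_all)
  finally show ?thesis .
qed

section \<open>The two-step transfer operator and free walks\<close>

lemma contact_kernel_nonneg: "0 \<le> z \<Longrightarrow> 0 \<le> contact_kernel z i n k"
proof (induction n arbitrary: k)
  case (Suc n)
  then show ?case by (cases k) (simp_all add: add_nonneg_nonneg)
qed simp

lemma contact_kernel_support: "n + i < k \<Longrightarrow> contact_kernel z i n k = 0"
proof (induction n arbitrary: k)
  case (Suc n)
  then show ?case by (cases k) simp_all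
qed simp

text \<open>The weight \<open>1 / z\<close> at the wall makes \<open>double_step z\<close> symmetric, up to a boundary term at \<open>K\<close>.\<close>

definition contact_inner :: "real \<Rightarrow> nat \<Rightarrow> (nat \<Rightarrow> real) \<Rightarrow> (nat \<Rightarrow> real) \<Rightarrow> real" where
  "contact_inner z K f g = f 0 * g 0 / z + (\<Sum>k=1..K. f k * g k)"

text \<open>A discrete Green identity: the interior terms telescope in \<open>K\<close>, and at the
  wall \<open>1 / z\<close> cancels the factor \<open>z\<close> of
  \<open>double_step\<close>.\<close>

lemma contact_inner_double_step:
  assumes "z \<noteq> 0"
  shows "contact_inner z K f (double_step z g) - contact_inner z K (double_step z f) g =
    f K * g (Suc K) - f (Suc K) * g K"
  using assms by (induction K) (simp_all add: contact_inner_def field_simps)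

section \<open>Free walks of \<open>2 * n\<close> steps ending at height \<open>2 * k\<close>:
  central binomial and Catalan estimates\<close>

definition walk :: "nat \<Rightarrow> nat \<Rightarrow> real" where
  "walk n k = real ((2 * n) choose (n + k))"

lemma walk_Suc_0: "walk (Suc n) 0 = 2 * walk n 0 + 2 * walk n 1"
proof (cases n)
  case (Suc m)
  have "(2 * n) choose m = (2 * n) choose (Suc n)"
    using Suc binomial_symmetric[of m "2 * n"] by (simp add: Suc_diff_le)
  then show ?thesis using Suc by (simp add: walk_def)
qed (simp add: walk_def)

lemma walk_Suc_Suc: "walk (Suc n) (Suc k) = walk n k + 2 * walk n (Suc k) + walk n (Suc (Suc k))"
  by (simp add: walk_def)

lemma walk_nonneg: "0 \<le> walk n k"
  by (simp add: walk_def)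

lemma walk_le: "walk n k \<le> 4 ^ n"
proof -
  have "real ((2 * n) choose (n + k)) \<le> real (2 ^ (2 * n))"
    by (intro of_nat_mono binomial_le_pow2)
  then show ?thesis by (simp add: walk_def power_mult)
qed

lemma walk_support: "n < k \<Longrightarrow> walk n k = 0"
  by (simp add: walk_def)

lemma walk_ratio: "real (Suc (n + k)) * walk n (Suc k) = (real n - real k) * walk n k"
proof (cases "k \<le> n")
  case True
  have "Suc (n + k) * (2 * n choose Suc (n + k)) = (2 * n - (n + k)) * (2 * n choose (n + k))"
    using binomial_absorb_comp[of "2 * n" "n + k"] Suc_times_binomial_eq[of "2*n - 1" "n + k"]
    by (cases n) (auto simp: mult.commute)
  then have "real (Suc (n + k)) * walk n (Suc k) = real (2 * n - (n + k)) * walk n k"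
    unfolding walk_def by (metis add_Suc_right of_nat_mult)
  then show ?thesis using True by (simp add: of_nat_diff)
qed (simp add: walk_support)

lemma walk_0_lower: "4 ^ n \<le> (2 * real n + 1) * walk n 0"
proof (cases "n = 0")
  case False
  then have "4 ^ n \<le> 2 * real n * walk n 0"
    using central_binomial_lower_bound[of n] by (simp add: walk_def field_simps)
  then show ?thesis using walk_nonneg[of n 0] by (simp add: distrib_right)
qed (simp add: walk_def)

lemma walk_0_Suc: "(real n + 1) * walk (Suc n) 0 = 2 * (2 * real n + 1) * walk n 0"
  using walk_ratio[of n 0] by (simp add: walk_Suc_0 algebra_simps)

text \<open>The factor \<open>2 * real n + 1\<close> lets the induction close, because
  \<open>(2 * n + 3) * (2 * n + 1)\<close> is at most \<open>(2 * n + 2) ^ 2\<close>.\<close>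

lemma walk_0_upper: "(2 * real n + 1) * (walk n 0)\<^sup>2 \<le> 16 ^ n"
proof (induction n)
  case (Suc n)
  have "2 * real (Suc n) + 1 = 2 * real n + 3" by simp
  then have "(real n + 1)\<^sup>2 * ((2 * real (Suc n) + 1) * (walk (Suc n) 0)\<^sup>2) =
     (2 * real n + 3) * ((real n + 1) * walk (Suc n) 0)\<^sup>2"
    by (simp only: power_mult_distrib mult_ac)
  also have "\<dots> = 4 * (2 * real n + 3) * (2 * real n + 1) * ((2 * real n + 1) * (walk n 0)\<^sup>2)"
    unfolding walk_0_Suc by (simp add: power2_eq_square algebra_simps)
  also have "\<dots> \<le> 4 * (2 * real n + 3) * (2 * real n + 1) * 16 ^ n"
    by (intro mult_left_mono Suc.IH) simp_all
  also have "\<dots> \<le> (real n + 1)\<^sup>2 * 16 ^ Suc n"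
    by (simp add: algebra_simps power2_eq_square)
  finally show ?case
    by (rule mult_left_le_imp_le) simp
qed (simp add: walk_def)

text \<open>The Catalan number in the form that the reflection principle produces.\<close>

definition catalan :: "nat \<Rightarrow> real" where
  "catalan n = walk n 0 - walk n 1"

lemma catalan_eq: "catalan n = walk n 0 / (real n + 1)"
  using walk_ratio[of n 0] by (simp add: catalan_def field_simps)

lemma catalan_nonneg: "0 \<le> catalan n"
  by (simp add: catalan_eq walk_nonneg)

text \<open>The exact ratio to \<open>catalan n\<close> is \<open>3 * n / (n + 2)\<close>. Used for
  the lower bound \<open>G_1_ge\<close>.\<close>

lemma walk_1_diff_le: "walk n 1 - walk n 2 \<le> 3 * catalan n"
proof -
  have 1: "walk n 1 = real n * catalan n" 
    using walk_ratio[of n 0] by (simp add: catalan_eq field_simps)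
  have "(real n + 2) * walk n 2 = (real n - 1) * walk n 1"
    using walk_ratio[of n 1] by (simp add: numeral_2_eq_2 add.commute)
  then have "(real n + 2) * (walk n 1 - walk n 2) = 3 * walk n 1"
    by (simp add: algebra_simps)
  also have "\<dots> = 3 * real n * catalan n" unfolding 1 by simp
  also have "\<dots> \<le> (real n + 2) * (3 * catalan n)"
    using catalan_nonneg[of n] by (simp add: algebra_simps)
  finally show ?thesis by (rule mult_left_le_imp_le) simp
qed

lemma catalan_lower: "4 ^ n / ((2 * real n + 1) * (real n + 1)) \<le> catalan n"
proof -
  have "4 ^ n / (2 * real n + 1) \<le> walk n 0"
    using walk_0_lower[of n] by (simp add: divide_le_eq mult.commute)
  from divide_right_mono[OF this, of "real n + 1"] show ?thesis
    by (simp add: catalan_eq)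
qed

text \<open>The square root matters: at two arguments proportional to \<open>n\<close> the product
  of these bounds is of order \<open>4 ^ n / n ^ 3\<close>, against a lower bound of order
  \<open>4 ^ n / n ^ 2\<close> for \<open>G n 1\<close>.\<close>

lemma catalan_upper: "catalan n \<le> 4 ^ n / ((real n + 1) * sqrt (2 * real n + 1))"
proof -
  have sixteen: "(4 ^ n)\<^sup>2 = (16 :: real) ^ n"
    by (simp add: power2_eq_square flip: power_mult_distrib)
  have "(sqrt (2 * real n + 1) * walk n 0)\<^sup>2 \<le> (4 ^ n)\<^sup>2"
    using walk_0_upper[of n] by (simp add: power_mult_distrib sixteen)
  then have "sqrt (2 * real n + 1) * walk n 0 \<le> 4 ^ n"
    by (rule power2_le_imp_le) simp
  then have "walk n 0 \<le> 4 ^ n / sqrt (2 * real n + 1)"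
    by (simp add: pos_le_divide_eq mult.commute)
  from divide_right_mono[OF this, of "real n + 1"] show ?thesis
    by (simp add: catalan_eq mult.commute)
qed

lemma tendsto_0_bound:
  fixes f g :: "nat \<Rightarrow> real"
  assumes "eventually (\<lambda>n. \<bar>f n\<bar> \<le> g n) sequentially" "g \<longlonglongrightarrow> 0"
  shows "f \<longlonglongrightarrow> 0"
  using assms(2) by (rule tendsto_0_le[where K = 1]) (use assms(1) in eventually_elim, simp)

section \<open>The adsorbed phase\<close>

locale adsorbed =
  fixes z :: real
  assumes z_gt: "2 < z"
begin

section \<open>The ground state and its eigenvalue\<close>

definition p :: real where "p = 1 / (z - 1)"
definition growth :: real where "growth = z\<^sup>2 / (z - 1)"

abbreviation U :: "nat \<Rightarrow> nat \<Rightarrow> real" where "U \<equiv> contact_kernel z 0"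
abbreviation V :: "nat \<Rightarrow> nat \<Rightarrow> real" where "V \<equiv> contact_kernel z 1"
abbreviation inner :: "nat \<Rightarrow> (nat \<Rightarrow> real) \<Rightarrow> (nat \<Rightarrow> real) \<Rightarrow> real" where
  "inner \<equiv> contact_inner z"

lemma p_pos: "0 < p" and p_less_1: "p < 1" and p_z: "(z - 1) * p = 1" and z_p: "z * p = 1 + p"
  using z_gt by (simp_all add: p_def field_simps)

lemma growth_alt: "growth = z\<^sup>2 * p"
  by (simp add: growth_def p_def)

lemma growth_eq: "growth = (1 + p)\<^sup>2 / p"
  using p_pos by (simp add: growth_alt power2_eq_square flip: z_p)

text \<open>The gap \<open>growth - 4\<close> equals \<open>(1 - p) ^ 2 / p\<close>.\<close>

lemma growth_gt: "4 < growth"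
proof -
  have "0 < (1 - p)\<^sup>2" using p_less_1 by simp
  then show ?thesis using p_pos by (simp add: growth_eq field_simps power2_eq_square)
qed

lemma growth_p: "growth * p = (1 + p)\<^sup>2"
  using p_pos by (simp add: growth_eq)

lemma double_step_ground: "double_step z (\<lambda>k. p ^ k) k = growth * p ^ k"
proof (cases k)
  case 0
  then show ?thesis by (simp add: growth_alt power2_eq_square flip: z_p)
next
  case (Suc i)
  have "growth * p ^ k = (growth * p) * p ^ i" by (simp add: Suc)
  then show ?thesis by (simp add: Suc growth_p power2_eq_square algebra_simps)
qed

lemma inner_double_step_ground:
  "inner K (double_step z (\<lambda>k. p ^ k)) f = growth * inner K (\<lambda>k. p ^ k) f"
  by (simp add: contact_inner_def double_step_ground sum_distrib_left algebra_simps
      del: double_step_simps)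

section \<open>The orthogonal complement of the ground state\<close>

text \<open>The evolution of \<open>V 0 - (1 + p) * U 0\<close>, which is orthogonal to the ground state. Precisely for
  this initial state the wall can be replaced by a finite image charge: it is the free walk from
  \<open>1\<close>, \<open>0\<close> and \<open>- 1\<close> with charges \<open>1\<close>, \<open>- (1 + p)\<close> and \<open>p\<close>.\<close>

definition w :: "nat \<Rightarrow> nat \<Rightarrow> real" where
  "w n k = (case k of 0 \<Rightarrow> - (1 + p) * catalan n
     | Suc i \<Rightarrow> walk n i - (1 + p) * walk n (Suc i) + p * walk n (Suc (Suc i)))"

lemma w_simps [simp]:
  "w n 0 = - (1 + p) * catalan n"
  "w n (Suc k) = walk n k - (1 + p) * walk n (Suc k) + p * walk n (Suc (Suc k))"
  by (simp_all add: w_def)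

text \<open>The value at \<open>0\<close> continues the formula for positive \<open>k\<close>, since
  the free walk is even. Hence only the condition at the wall needs more than the free recursion,
  and it reduces to \<open>z * p = 1 + p\<close>.\<close>

lemma w_Suc: "w (Suc n) = double_step z (w n)"
proof
  fix k
  show "w (Suc n) k = double_step z (w n) k"
  proof (cases k)
    case 0
    have "double_step z (w n) 0 = z * p * (walk n 2 - walk n 0)"
      by (simp add: catalan_def algebra_simps numeral_2_eq_2)
    then show ?thesis 
      using 0 walk_Suc_Suc[of n 0]
      by (simp only: z_p) (simp add: catalan_def walk_Suc_0 numeral_2_eq_2 algebra_simps)
  next
    case (Suc i)
    then show ?thesis
    proof (cases i)
      case 0
      then show ?thesis
        by (simp add: Suc catalan_def walk_Suc_0 walk_Suc_Suc algebra_simps)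
    qed (simp add: walk_Suc_Suc algebra_simps)
  qed
qed

text \<open>Both sides obey the same linear recursion. Replacing \<open>V\<close> by
  \<open>w\<close> is thus a column operation, which leaves the determinant in
  \<open>C_eq_det\<close> unchanged.\<close>

lemma w_eq: "w n k = V n k - (1 + p) * U n k"
proof (induction n arbitrary: k)
  case 0
  show ?case by (cases k) (auto simp: catalan_def walk_def)
next
  case (Suc n)
  show ?case
    by (cases k) (simp_all add: w_Suc Suc.IH del: w_simps, simp_all add: algebra_simps)
qed

lemma w_support: "Suc n < k \<Longrightarrow> w n k = 0"
  by (cases k) (simp_all add: walk_support)

lemma w_bound: "\<bar>w n k\<bar> \<le> 4 * 4 ^ n"
proof -
  have *: "0 \<le> walk n i \<and> walk n i \<le> 4 ^ n \<and> 0 \<le> p * walk n i \<and> p * walk n i \<le> 4 ^ n" for i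
    using walk_le[of n i] walk_nonneg[of n i] p_pos p_less_1
      mult_mono[of p 1 "walk n i" "4 ^ n"] by auto
  show ?thesis
  proof (cases k)
    case 0
    then have "w n k = walk n 1 + p * walk n 1 - walk n 0 - p * walk n 0"
      by (simp add: catalan_def algebra_simps)
    then show ?thesis using *[of 0] *[of 1] by linarith
  next
    case (Suc i)
    then have "w n k = walk n i - walk n (Suc i) - p * walk n (Suc i) + p * walk n (Suc (Suc i))"
      by (simp add: algebra_simps)
    then show ?thesis using *[of i] *[of "Suc i"] *[of "Suc (Suc i)"] by linarith
  qed
qed

text \<open>Symmetry propagates the orthogonality from \<open>n = 0\<close>. The cutoff is exact
  because \<open>w n\<close> vanishes beyond \<open>Suc n\<close>, which kills the boundary
  term.\<close>

lemma inner_ground_w: "n < K \<Longrightarrow> inner K (\<lambda>k. p ^ k) (w n) = 0"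
proof (induction n)
  case 0
  have "inner K (\<lambda>k. p ^ k) (w 0) = w 0 0 / z + (\<Sum>k=1..K. p ^ k * w 0 k)"
    by (simp add: contact_inner_def)
  also have "(\<Sum>k=1..K. p ^ k * w 0 k) = (\<Sum>k\<in>{1}. p ^ k * w 0 k)"
    using 0 by (intro sum.mono_neutral_right) (auto simp: w_support simp del: w_simps)
  finally show ?case using z_gt z_p by (simp add: catalan_def walk_def field_simps)
next
  case (Suc n)
  have "inner K (\<lambda>k. p ^ k) (w (Suc n)) = inner K (double_step z (\<lambda>k. p ^ k)) (w n)"
    using contact_inner_double_step[of z K "\<lambda>k. p ^ k" "w n"] z_gt Suc.prems
    by (simp add: w_Suc w_support del: w_simps)
  also have "\<dots> = growth * inner K (\<lambda>k. p ^ k) (w n)"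
    by (rule inner_double_step_ground)
  finally show ?case using Suc by simp
qed

text \<open>The same symmetry argument; this exact identity later fixes the amplitude of
  \<open>U n 0\<close>.\<close>

lemma inner_ground_U: "n \<le> K \<Longrightarrow> inner K (\<lambda>k. p ^ k) (U n) = growth ^ n / z"
proof (induction n)
  case 0
  then show ?case by (auto simp: contact_inner_def intro!: sum.neutral)
next
  case (Suc n)
  have "inner K (\<lambda>k. p ^ k) (U (Suc n)) = inner K (double_step z (\<lambda>k. p ^ k)) (U n)"
    using contact_inner_double_step[of z K "\<lambda>k. p ^ k" "U n"] z_gt Suc.prems
    by (simp add: contact_kernel_support)
  also have "\<dots> = growth * inner K (\<lambda>k. p ^ k) (U n)"
    by (rule inner_double_step_ground)
  finally show ?case using Suc by simp
qed

definition G :: "nat \<Rightarrow> nat \<Rightarrow> real" where "G n k = w n k - p ^ k * w n 0"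

text \<open>Symmetry moves time steps from the first argument to the second until \<open>w 0\<close>
  is left. It lives on \<open>0\<close> and \<open>1\<close> only, and
  \<open>(1 + p) / z = p\<close>.\<close>

lemma inner_w_w: "a + b < K \<Longrightarrow> inner K (w a) (w b) = G (a + b) 1"
proof (induction a arbitrary: b)
  case 0
  have "(\<Sum>k=1..K. w 0 k * w b k) = (\<Sum>k\<in>{1}. w 0 k * w b k)"
    using 0 by (intro sum.mono_neutral_right) (auto simp: w_support simp del: w_simps)
  moreover have "w 0 0 = - (1 + p)" "w 0 1 = 1" by (simp_all add: catalan_def walk_def)
  moreover have "(1 + p) / z = p" using z_p z_gt by (simp add: field_simps)
  then have "- (1 + p) * x / z = - p * x" for x
    using z_gt by (simp flip: z_p)
  ultimately show ?case
    by (simp add: contact_inner_def G_def del: w_simps)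
next
  case (Suc a)
  have "inner K (w (Suc a)) (w b) = inner K (w a) (w (Suc b))"
    using contact_inner_double_step[of z K "w a" "w b"] z_gt Suc.prems
    by (simp add: w_Suc w_support del: w_simps)
  then show ?case using Suc by simp
qed

text \<open>The constant is \<open>1 + p + p ^ 2 - 3 * p\<close>, with the \<open>3\<close> of
  \<open>walk_1_diff_le\<close>.\<close>

lemma G_1_ge: "(1 - p)\<^sup>2 * catalan n \<le> G n 1"
proof -
  have "G n 1 = (1 + p + p\<^sup>2) * catalan n - p * (walk n 1 - walk n 2)"
    by (simp add: G_def catalan_def numeral_2_eq_2 algebra_simps)
  moreover have "p * (walk n 1 - walk n 2) \<le> p * (3 * catalan n)"
    using p_pos by (intro mult_left_mono walk_1_diff_le) simp
  ultimately show ?thesis by (simp add: algebra_simps power2_eq_square)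
qed

section \<open>Convergence of the bottom walk to the ground state\<close>

text \<open>The difference \<open>U n k - (z - 1) * U n (k + 1)\<close> vanishes on the ground state, and its own
  recursion has coefficients that sum to at most \<open>4\<close>.\<close>

lemma U_defect_bound: "\<bar>U n k - (z - 1) * U n (Suc k)\<bar> \<le> 4 ^ n"
proof (induction n arbitrary: k)
  case (Suc n)
  define y where "y k = U n k - (z - 1) * U n (Suc k)" for k
  have y: "\<bar>y k\<bar> \<le> 4 ^ n" for k using Suc.IH by (simp add: y_def)
  show ?case
  proof (cases k)
    case 0
    have "U (Suc n) k - (z - 1) * U (Suc n) (Suc k) = y 0 + y 1"
      by (simp add: 0 y_def algebra_simps)
    then show ?thesis using y[of 0] y[of 1] by simp
  next
    case (Suc i)
    have "U (Suc n) k - (z - 1) * U (Suc n) (Suc k) = y i + 2 * y (Suc i) + y (Suc (Suc i))"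
      by (simp add: Suc y_def algebra_simps)
    then show ?thesis using y[of i] y[of "Suc i"] y[of "Suc (Suc i)"] by simp
  qed
qed auto

text \<open>The solution of \<open>M = p * M + p\<close>, which closes the induction in
  \<open>U_ground_bound\<close>.\<close>

definition M :: real where "M = p / (1 - p)"

lemma M_nonneg: "0 \<le> M"
  using p_pos p_less_1 by (simp add: M_def)

text \<open>Induction on the height: since \<open>p * (z - 1) = 1\<close>, a step up contracts the
  previous deviation by \<open>p\<close> and adds \<open>p\<close> times a defect, so the bound is
  uniform in \<open>k\<close>.\<close>

lemma U_ground_bound: "\<bar>U n k - p ^ k * U n 0\<bar> \<le> M * 4 ^ n"
proof (induction k)
  case 0
  then show ?case using M_nonneg by simp
next
  case (Suc k)
  have "p * ((z - 1) * U n (Suc k)) = U n (Suc k)"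
    using p_z by (metis mult.assoc mult.commute mult_1)
  then have "U n (Suc k) - p ^ Suc k * U n 0 =
    p * (U n k - p ^ k * U n 0) - p * (U n k - (z - 1) * U n (Suc k))"
    by (simp add: right_diff_distrib)
  also have "\<bar>\<dots>\<bar> \<le> p * \<bar>U n k - p ^ k * U n 0\<bar> + p * \<bar>U n k - (z - 1) * U n (Suc k)\<bar>"
    using p_pos abs_triangle_ineq4 by (metis abs_mult abs_of_pos)
  also have "\<dots> \<le> p * (M * 4 ^ n) + p * 4 ^ n"
    using p_pos by (intro add_mono mult_left_mono Suc.IH U_defect_bound) simp_all
  also have "\<dots> = M * 4 ^ n"
    using p_less_1 by (simp add: M_def field_simps)
  finally show ?case .
qed

text \<open>All terms are nonnegative, so the wall term is at most the full inner product of
  \<open>inner_ground_U\<close>.\<close>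

lemma U_0_le: "U n 0 \<le> growth ^ n"
proof -
  have "U n 0 / z \<le> inner n (\<lambda>k. p ^ k) (U n)"
    using z_gt p_pos by (auto simp: contact_inner_def intro!: sum_nonneg mult_nonneg_nonneg contact_kernel_nonneg)
  then show ?thesis using inner_ground_U[of n n] z_gt by (simp add: divide_le_cancel)
qed

text \<open>Writing \<open>U n k\<close> as \<open>p ^ k * U n 0\<close> plus a deviation of order
  \<open>4 ^ n\<close> turns \<open>inner_ground_U\<close> into a linear equation for
  \<open>U n 0\<close>. The limit is \<open>1 / z\<close> over the squared norm of the ground
  state.\<close>

lemma U_0_tendsto: "(\<lambda>n. U n 0 / growth ^ n) \<longlonglongrightarrow> 1 - p"
proof -
  let ?S = "\<lambda>n. \<Sum>k=1..n. (p\<^sup>2) ^ k"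
  let ?e = "\<lambda>n. \<Sum>k=1..n. p ^ k * (U n k - p ^ k * U n 0)"
  have p2: "\<bar>p\<^sup>2\<bar> < 1" using p_pos p_less_1 by (simp add: abs_square_less_1)
  have p1: "\<bar>p\<bar> < 1" using p_pos p_less_1 by simp
  have S: "?S \<longlonglongrightarrow> p\<^sup>2 / (1 - p\<^sup>2)"
  proof -
    have "(\<lambda>k. p\<^sup>2 * (p\<^sup>2) ^ k) sums (p\<^sup>2 * (1 / (1 - p\<^sup>2)))"
      using p2 by (intro sums_mult geometric_sums) simp
    then have "(\<lambda>n. \<Sum>k<n. (p\<^sup>2) ^ Suc k) \<longlonglongrightarrow> p\<^sup>2 * (1 / (1 - p\<^sup>2))"
      by (simp add: sums_def)
    moreover have "(\<Sum>k<n. (p\<^sup>2) ^ Suc k) = ?S n" for n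
      by (metis One_nat_def lessThan_atLeast0 sum.shift_bounds_Suc_ivl atLeastLessThanSuc_atLeastAtMost)
    ultimately show ?thesis by simp
  qed
  have split: "U n 0 / growth ^ n * (1 / z + ?S n) = 1 / z - ?e n / growth ^ n" for n
  proof -
    have "growth ^ n / z = U n 0 / z + (\<Sum>k=1..n. p ^ k * U n k)"
      using inner_ground_U[of n n] by (simp add: contact_inner_def)
    also have "(\<Sum>k=1..n. p ^ k * U n k) = U n 0 * ?S n + ?e n"
      by (simp add: sum_distrib_left sum_subtractf algebra_simps power2_eq_square power_mult_distrib)
    finally have "U n 0 * (1 / z + ?S n) = growth ^ n / z - ?e n"
      by (simp add: distrib_left)
    then have "U n 0 / growth ^ n * (1 / z + ?S n) = (growth ^ n / z - ?e n) / growth ^ n"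
      by (metis times_divide_eq_left)
    then show ?thesis using growth_gt by (simp add: diff_divide_distrib)
  qed
  have e: "\<bar>?e n\<bar> \<le> real n * (M * 4 ^ n)" for n
  proof -
    have "\<bar>?e n\<bar> \<le> (\<Sum>k=1..n. 1 * (M * 4 ^ n))"
      using p_pos p_less_1 U_ground_bound
      by (intro order.trans[OF sum_abs] sum_mono, unfold abs_mult, intro mult_mono)
        (auto simp: power_le_one)
    then show ?thesis by simp
  qed
  have "(\<lambda>n. ?e n / growth ^ n) \<longlonglongrightarrow> 0"
  proof (rule tendsto_0_bound)
    show "\<forall>\<^sub>F n in sequentially. \<bar>?e n / growth ^ n\<bar> \<le> M * (real n * (4 / growth) ^ n)"
      using e growth_gt by (auto simp: field_simps intro!: always_eventually)
    have "(\<lambda>n. real n * (4 / growth) ^ n) \<longlonglongrightarrow> 0"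
      using growth_gt by (intro powser_times_n_limit_0) simp
    then show "(\<lambda>n. M * (real n * (4 / growth) ^ n)) \<longlonglongrightarrow> 0"
      by (rule tendsto_mult_right_zero)
  qed
  then have "(\<lambda>n. (1 / z - ?e n / growth ^ n) / (1 / z + ?S n)) \<longlonglongrightarrow> (1 / z - 0) / (1 / z + p\<^sup>2 / (1 - p\<^sup>2))"
    using z_gt p2 by (intro tendsto_intros S) (auto simp: add_pos_nonneg less_imp_neq[symmetric])
  also have "(1 / z - 0) / (1 / z + p\<^sup>2 / (1 - p\<^sup>2)) = 1 - p"
  proof -
    \<comment> \<open>With \<open>x = 1 / z\<close> the squared norm is
      \<open>x / (1 - p)\<close>.\<close>
    have 1: "1 / z = p / (1 + p)" using z_p z_gt p_pos by (simp add: field_simps)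
    have 2: "p\<^sup>2 / (1 - p\<^sup>2) = p / (1 + p) * (p / (1 - p))"
      by (simp add: power2_eq_square algebra_simps)
    define x where "x = p / (1 + p)"
    have "x \<noteq> 0" using p_pos by (simp add: x_def)
    moreover have "x + x * (p / (1 - p)) = x / (1 - p)"
      using p_less_1 by (simp add: field_simps)
    ultimately show ?thesis unfolding 1 2 x_def[symmetric] by (simp only:) simp
  qed
  also have "(\<lambda>n. (1 / z - ?e n / growth ^ n) / (1 / z + ?S n)) = (\<lambda>n. U n 0 / growth ^ n)"
  proof
    fix n
    have "0 < 1 / z + ?S n" using z_gt by (intro add_pos_nonneg sum_nonneg) simp_all
    then show "(1 / z - ?e n / growth ^ n) / (1 / z + ?S n) = U n 0 / growth ^ n"
      unfolding split[symmetric] by simp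
  qed
  finally show ?thesis .
qed

section \<open>The determinant as main term plus error\<close>

definition err :: "nat \<Rightarrow> nat \<Rightarrow> real" where
  "err n k = - (U n k - p ^ k * U n 0) * w n 0"

text \<open>After the column operation of \<open>w_eq\<close>, the ground state part of
  \<open>U n\<close> gives the main term. In \<open>err\<close> both factors are at most of order
  \<open>4 ^ n\<close>.\<close>

lemma C_eq: "C n z j = U n 0 * G n (Suc j) + err n (Suc j)"
  by (simp add: C_eq_det err_def G_def w_eq algebra_simps del: w_simps)

lemma err_bound: "\<bar>err n k\<bar> \<le> 4 * M * 16 ^ n"
proof -
  have "\<bar>err n k\<bar> = \<bar>U n k - p ^ k * U n 0\<bar> * \<bar>w n 0\<bar>"
    by (simp only: err_def abs_mult abs_minus_cancel)
  also have "\<dots> \<le> (M * 4 ^ n) * (4 * 4 ^ n)"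
    using M_nonneg by (intro mult_mono U_ground_bound w_bound) simp_all
  also have "\<dots> = 4 * M * 16 ^ n"
    by (simp flip: power_mult_distrib)
  finally show ?thesis .
qed

lemma G_bound: "\<bar>G n k\<bar> \<le> 8 * 4 ^ n"
proof -
  have "\<bar>G n k\<bar> \<le> \<bar>w n k\<bar> + p ^ k * \<bar>w n 0\<bar>"
    unfolding G_def using p_pos abs_triangle_ineq4[of "w n k" "p ^ k * w n 0"]
    by (simp add: abs_mult del: w_simps)
  also have "\<dots> \<le> 4 * 4 ^ n + 1 * (4 * 4 ^ n)"
    using p_pos p_less_1 by (intro add_mono mult_mono w_bound) (simp_all add: power_le_one)
  finally show ?thesis by simp
qed

text \<open>The squared norm of the ground state for \<open>contact_inner\<close>, with the cutoff
  removed.\<close>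

definition ground_norm :: real where "ground_norm = 1 / z + p\<^sup>2 / (1 - p\<^sup>2)"

lemma ground_norm_bound: "\<bar>inner K (\<lambda>k. p ^ k) (\<lambda>k. p ^ k)\<bar> \<le> ground_norm"
proof -
  have p2: "p\<^sup>2 < 1" using p_pos p_less_1 by (simp add: abs_square_less_1)
  have "(1 - x) * (\<Sum>k=1..K. x ^ k) = x - x ^ Suc K" for x :: real
  proof (induction K)
    case (Suc K)
    then show ?case by (simp add: distrib_left) (simp add: algebra_simps)
  qed simp
  from this[of "p\<^sup>2"] have "(1 - p\<^sup>2) * (\<Sum>k=1..K. p ^ k * p ^ k) = p\<^sup>2 - (p\<^sup>2) ^ Suc K"
    by (simp add: power2_eq_square power_mult_distrib)
  then have "(1 - p\<^sup>2) * (\<Sum>k=1..K. p ^ k * p ^ k) \<le> p\<^sup>2" by simp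
  then have "(\<Sum>k=1..K. p ^ k * p ^ k) \<le> p\<^sup>2 / (1 - p\<^sup>2)"
    using p2 by (simp add: pos_le_divide_eq mult.commute)
  moreover have "0 \<le> (\<Sum>k=1..K. p ^ k * p ^ k)"
    using p_pos by (intro sum_nonneg) simp
  ultimately show ?thesis using z_gt by (simp add: contact_inner_def ground_norm_def)
qed

text \<open>Expanding \<open>G\<close> gives four inner products: the mixed ones vanish by
  orthogonality, \<open>inner_w_w\<close> yields \<open>G n 1\<close>, and the last carries
  \<open>w a 0 * w b 0\<close>, hence two Catalan numbers.\<close>

lemma sum_G_G:
  assumes "a + b = n"
  shows "\<bar>(\<Sum>j=0..n. G a (Suc j) * G b (Suc j)) - G n 1\<bar> \<le>
    (1 + p)\<^sup>2 * ground_norm * (catalan a * catalan b)"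
proof -
  \<comment> \<open>The shifted sum ends at \<open>Suc n\<close>, and this cutoff just satisfies
    \<open>a + b < Suc n\<close>.\<close>
  let ?\<phi> = "\<lambda>k. p ^ k" and ?K = "Suc n"
  have "(\<Sum>j=0..n. G a (Suc j) * G b (Suc j)) = (\<Sum>k=1..?K. G a k * G b k)"
    by (simp only: sum.shift_bounds_cl_Suc_ivl One_nat_def)
  \<comment> \<open>The wall terms of the four inner products cancel, because
    \<open>G a 0 = 0\<close>.\<close>
  also have "\<dots> = inner ?K (w a) (w b) - w a 0 * inner ?K ?\<phi> (w b) - w b 0 * inner ?K ?\<phi> (w a)
      + w a 0 * w b 0 * inner ?K ?\<phi> ?\<phi>"
  proof -
    have "(\<Sum>k=1..?K. G a k * G b k) = (\<Sum>k=1..?K. w a k * w b k - w a 0 * (p ^ k * w b k)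
        - w b 0 * (p ^ k * w a k) + w a 0 * w b 0 * (p ^ k * p ^ k))"
      by (intro sum.cong refl) (simp add: G_def algebra_simps del: w_simps)
    then show ?thesis
      by (simp add: contact_inner_def sum.distrib sum_subtractf sum_distrib_left[symmetric] distrib_left
          del: w_simps sum.cl_ivl_Suc)
  qed
  also have "\<dots> = G n 1 + w a 0 * w b 0 * inner ?K ?\<phi> ?\<phi>"
    using assms by (simp add: inner_ground_w inner_w_w del: w_simps)
  finally have "(\<Sum>j=0..n. G a (Suc j) * G b (Suc j)) - G n 1 =
      (1 + p)\<^sup>2 * (catalan a * catalan b) * inner ?K ?\<phi> ?\<phi>"
    by (simp add: power2_eq_square algebra_simps)
  also have "\<bar>\<dots>\<bar> = (1 + p)\<^sup>2 * (catalan a * catalan b) * \<bar>inner ?K ?\<phi> ?\<phi>\<bar>"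
    by (simp add: abs_mult catalan_nonneg)
  also have "\<dots> \<le> (1 + p)\<^sup>2 * (catalan a * catalan b) * ground_norm"
    by (intro mult_left_mono ground_norm_bound mult_nonneg_nonneg catalan_nonneg) simp
  finally show ?thesis by (simp add: mult_ac)
qed

text \<open>\<open>32 * M\<close> is \<open>8 * (4 * M)\<close>, from a main term times an error;
  \<open>(4 * M) ^ 2\<close> comes from two errors.\<close>

definition err_const :: real where "err_const = 32 * M + 16 * M\<^sup>2"

text \<open>An error in a segment of length \<open>m\<close> puts \<open>16 ^ m\<close> in place of
  \<open>(4 * growth) ^ m\<close>, a relative size of \<open>(4 / growth) ^ m\<close>. The sum over
  \<open>j\<close> costs the factor \<open>real n + 1\<close>.\<close>

lemma Z_star_bound:
  assumes "q \<le> n"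
  shows "\<bar>Z_star n z q - U q 0 * U (n - q) 0 * (\<Sum>j=0..n. G q (Suc j) * G (n - q) (Suc j))\<bar> \<le>
    (real n + 1) * (err_const * (4 * growth) ^ n * (2 * (4 / growth) ^ q + (4 / growth) ^ (n - q)))"
proof -
  define r where "r = n - q"
  have n: "n = q + r" using assms by (simp add: r_def)
  have g: "4 < growth" by (rule growth_gt)
  have U: "\<bar>U m 0\<bar> \<le> growth ^ m" for m
    using U_0_le contact_kernel_nonneg[of z 0 m 0] z_gt by simp
  have *: "\<bar>C q z j * C r z j - U q 0 * U r 0 * (G q (Suc j) * G r (Suc j))\<bar> \<le>
    err_const * ((growth * 4) ^ q * 16 ^ r + (growth * 4) ^ r * 16 ^ q + 16 ^ q * 16 ^ r)" for j
  proof -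
    have "C q z j * C r z j - U q 0 * U r 0 * (G q (Suc j) * G r (Suc j)) =
      U q 0 * G q (Suc j) * err r (Suc j) + U r 0 * G r (Suc j) * err q (Suc j)
      + err q (Suc j) * err r (Suc j)"
      by (simp add: C_eq algebra_simps)
    also have "\<bar>\<dots>\<bar> \<le> \<bar>U q 0\<bar> * \<bar>G q (Suc j)\<bar> * \<bar>err r (Suc j)\<bar> + \<bar>U r 0\<bar> * \<bar>G r (Suc j)\<bar> * \<bar>err q (Suc j)\<bar>
      + \<bar>err q (Suc j)\<bar> * \<bar>err r (Suc j)\<bar>"
      unfolding abs_mult[symmetric] by linarith
    also have "\<dots> \<le> growth ^ q * (8 * 4 ^ q) * (4 * M * 16 ^ r) + growth ^ r * (8 * 4 ^ r) * (4 * M * 16 ^ q)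
      + (4 * M * 16 ^ q) * (4 * M * 16 ^ r)"
      using g M_nonneg by (intro add_mono mult_mono U G_bound err_bound) simp_all
    also have "\<dots> = 32 * M * ((growth * 4) ^ q * 16 ^ r + (growth * 4) ^ r * 16 ^ q)
      + 16 * M\<^sup>2 * (16 ^ q * 16 ^ r)"
      by (simp add: power_mult_distrib power2_eq_square algebra_simps)
    also have "\<dots> \<le> err_const * ((growth * 4) ^ q * 16 ^ r + (growth * 4) ^ r * 16 ^ q)
      + err_const * (16 ^ q * 16 ^ r)"
      unfolding err_const_def using g M_nonneg by (intro add_mono mult_right_mono) simp_all
    finally show ?thesis by (simp add: distrib_left)
  qed
  have "\<bar>Z_star n z q - U q 0 * U r 0 * (\<Sum>j=0..n. G q (Suc j) * G r (Suc j))\<bar> =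
    \<bar>\<Sum>j=0..n. C q z j * C r z j - U q 0 * U r 0 * (G q (Suc j) * G r (Suc j))\<bar>"
    by (simp add: Z_star_def r_def sum_subtractf sum_distrib_left)
  also have "\<dots> \<le> (\<Sum>j=0..n. err_const * ((growth * 4) ^ q * 16 ^ r + (growth * 4) ^ r * 16 ^ q + 16 ^ q * 16 ^ r))"
    by (rule order.trans[OF sum_abs]) (intro sum_mono *)
  also have "\<dots> = (real n + 1) * (err_const * ((growth * 4) ^ q * 16 ^ r + (growth * 4) ^ r * 16 ^ q + 16 ^ q * 16 ^ r))"
    by simp
  also have "\<dots> \<le> (real n + 1) * (err_const * ((4 * growth) ^ n * (2 * (4 / growth) ^ q + (4 / growth) ^ r)))"
  proof (intro mult_left_mono)
    have e: "16 ^ m = (growth * 4) ^ m * (4 / growth) ^ m" for m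
    proof -
      have "16 = growth * 4 * (4 / growth)" using g by simp
      then show ?thesis by (metis power_mult_distrib)
    qed
    \<comment> \<open>The product of both errors is absorbed into the term with \<open>q\<close>,
      hence its coefficient \<open>2\<close>.\<close>
    have "(4 / growth) ^ q * (4 / growth) ^ r \<le> (4 / growth) ^ q"
      using g by (intro mult_right_le_one_le) (simp_all add: power_le_one)
    then have "(growth * 4) ^ q * (growth * 4) ^ r * ((4 / growth) ^ r + (4 / growth) ^ q + (4 / growth) ^ q * (4 / growth) ^ r)
      \<le> (growth * 4) ^ q * (growth * 4) ^ r * (2 * (4 / growth) ^ q + (4 / growth) ^ r)"
      using g by (intro mult_left_mono) simp_all
    then show "(growth * 4) ^ q * 16 ^ r + (growth * 4) ^ r * 16 ^ q + 16 ^ q * 16 ^ r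
      \<le> (4 * growth) ^ n * (2 * (4 / growth) ^ q + (4 / growth) ^ r)"
      unfolding e n power_add by (simp add: algebra_simps del: power_divide)
    show "0 \<le> err_const" using M_nonneg by (simp add: err_const_def)
  qed simp
  finally show ?thesis by (simp add: r_def mult.assoc)
qed

section \<open>Limits for a contact far from both ends\<close>

lemma G_1_lower: "(1 - p)\<^sup>2 * 4 ^ n / ((2 * real n + 1) * (real n + 1)) \<le> G n 1"
  using mult_left_mono[OF catalan_lower[of n], of "(1 - p)\<^sup>2"] G_1_ge[of n] by simp

lemma G_1_bounds:
  "0 < G n 1" "4 ^ n / G n 1 \<le> (2 * real n + 1) * (real n + 1) / (1 - p)\<^sup>2"
proof -
  have "0 < (1 - p)\<^sup>2 * 4 ^ n / ((2 * real n + 1) * (real n + 1))"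
    using p_less_1 by (intro divide_pos_pos mult_pos_pos) simp_all
  then show pos: "0 < G n 1" using G_1_lower[of n] by linarith
  have "0 < (1 - p)\<^sup>2" using p_less_1 by simp
  moreover have "(1 - p)\<^sup>2 * 4 ^ n \<le> G n 1 * ((2 * real n + 1) * (real n + 1))"
    using G_1_lower[of n] by (simp add: pos_divide_le_eq)
  ultimately show "4 ^ n / G n 1 \<le> (2 * real n + 1) * (real n + 1) / (1 - p)\<^sup>2"
    using pos by (simp add: pos_divide_le_eq pos_le_divide_eq mult_ac)
qed

text \<open>Both lengths are at least \<open>b * real n\<close>, so \<open>catalan_upper\<close> and
  \<open>G_1_bounds\<close> leave a bound of order \<open>1 / n\<close>.\<close>

lemma catalan_product_tendsto:
  assumes b: "0 < b"
    and q: "eventually (\<lambda>n. q n \<le> n \<and> b * real n \<le> real (q n) \<and> b * real n \<le> real (n - q n)) sequentially"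
  shows "(\<lambda>n. catalan (q n) * catalan (n - q n) / G n 1) \<longlonglongrightarrow> 0"
proof (rule tendsto_0_bound)
  let ?f = "\<lambda>n. (2 * real n + 1) * (real n + 1) / (1 - p)\<^sup>2 / (b * real n + 1)\<^sup>2 / (2 * b * real n + 1)"
  have p1: "0 < (1 - p)\<^sup>2" using p_less_1 by simp
  have "(\<lambda>n. (2 * real n + 1) * (real n + 1) / (b * real n + 1)\<^sup>2 / (2 * b * real n + 1)) \<longlonglongrightarrow> 0"
    using b by real_asymp
  from tendsto_mult_right_zero[OF this, of "1 / (1 - p)\<^sup>2"] show "?f \<longlonglongrightarrow> 0"
    by (simp add: field_simps)
  show "\<forall>\<^sub>F n in sequentially. \<bar>catalan (q n) * catalan (n - q n) / G n 1\<bar> \<le> ?f n"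
    using q
  proof eventually_elim
    case (elim n)
    have cat: "catalan m \<le> 4 ^ m / ((b * real n + 1) * sqrt (2 * b * real n + 1))"
      if "b * real n \<le> real m" for m
    proof -
      have "catalan m \<le> 4 ^ m / ((real m + 1) * sqrt (2 * real m + 1))" by (rule catalan_upper)
      also have "\<dots> \<le> 4 ^ m / ((b * real n + 1) * sqrt (2 * b * real n + 1))"
        using that b by (intro divide_left_mono mult_mono mult_pos_pos) (auto simp: add_nonneg_pos)
      finally show ?thesis .
    qed
    have s: "sqrt (2 * b * real n + 1) * sqrt (2 * b * real n + 1) = 2 * b * real n + 1"
      using b by simp
    have "catalan (q n) * catalan (n - q n) \<le>
      4 ^ q n / ((b * real n + 1) * sqrt (2 * b * real n + 1)) *
      (4 ^ (n - q n) / ((b * real n + 1) * sqrt (2 * b * real n + 1)))"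
      using elim b by (intro mult_mono cat catalan_nonneg) auto
    also have "\<dots> = 4 ^ q n * 4 ^ (n - q n) / ((b * real n + 1)\<^sup>2 *
        (sqrt (2 * b * real n + 1) * sqrt (2 * b * real n + 1)))"
      by (simp add: power2_eq_square mult_ac)
    also have "4 ^ q n * 4 ^ (n - q n) = (4 :: real) ^ n"
      using elim by (simp flip: power_add)
    finally have "catalan (q n) * catalan (n - q n) / G n 1 \<le>
        4 ^ n / ((b * real n + 1)\<^sup>2 * (2 * b * real n + 1)) / G n 1"
      unfolding s using G_1_bounds(1)[of n] by (intro divide_right_mono) simp_all
    also have "\<dots> = 4 ^ n / G n 1 / ((b * real n + 1)\<^sup>2 * (2 * b * real n + 1))"
      by (simp only: divide_divide_eq_left mult.commute)
    also have "\<dots> \<le> (2 * real n + 1) * (real n + 1) / (1 - p)\<^sup>2 / ((b * real n + 1)\<^sup>2 * (2 * b * real n + 1))"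
      using b by (intro divide_right_mono G_1_bounds) simp
    finally show ?case
      using G_1_bounds(1)[of n] by (simp add: catalan_nonneg abs_mult)
  qed
qed

lemma exp_decay_tendsto:
  assumes "0 < b"
  shows "(\<lambda>n. K * ((real n + 1)\<^sup>2 * (2 * real n + 1) * (4 / growth) powr (b * real n))) \<longlonglongrightarrow> 0"
proof -
  define c where "c = - b * ln (4 / growth)"
  have "0 < c" using assms growth_gt by (simp add: c_def mult_less_0_iff zero_less_mult_iff ln_div)
  then have "(\<lambda>n. (real n + 1)\<^sup>2 * (2 * real n + 1) * exp (- c * real n)) \<longlonglongrightarrow> 0"
    by real_asymp
  also have "(\<lambda>n. exp (- c * real n)) = (\<lambda>n. (4 / growth) powr (b * real n))"
    using growth_gt by (simp add: c_def powr_def mult_ac)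
  then have "(\<lambda>n. (real n + 1)\<^sup>2 * (2 * real n + 1) * exp (- c * real n)) =
    (\<lambda>n. (real n + 1)\<^sup>2 * (2 * real n + 1) * (4 / growth) powr (b * real n))" by metis
  finally show ?thesis by (rule tendsto_mult_right_zero)
qed

text \<open>Numerator and denominator are divided by \<open>growth ^ n * G n 1\<close>. The former
  then tends to \<open>(1 - p) ^ 2\<close>, one factor for each segment, the latter to
  \<open>1 - p\<close>.\<close>

lemma ratio_tendsto:
  assumes b: "0 < b"
    and q: "eventually (\<lambda>n. q n \<le> n \<and> b * real n \<le> real (q n) \<and> b * real n \<le> real (n - q n)) sequentially"
  shows "(\<lambda>n. Z_star n z (q n) / C n z 0) \<longlonglongrightarrow> 1 - p"
proof -
  define \<theta> where "\<theta> = 4 / growth"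
  have \<theta>: "0 < \<theta>" "\<theta> < 1" using growth_gt by (simp_all add: \<theta>_def)
  have g: "0 < growth" using growth_gt by simp
  have pow: "\<theta> ^ m \<le> \<theta> powr (b * real n)" if "b * real n \<le> real m" for m n
    using \<theta> that by (simp add: powr_mono' flip: powr_realpow)
  let ?r = "\<lambda>n. n - q n"
  let ?D = "\<lambda>n. growth ^ n * G n 1"
  let ?S = "\<lambda>n. \<Sum>j=0..n. G (q n) (Suc j) * G (?r n) (Suc j)"
  let ?\<delta> = "\<lambda>n. (Z_star n z (q n) - U (q n) 0 * U (?r n) 0 * ?S n) / ?D n"
  let ?P = "\<lambda>n. (real n + 1)\<^sup>2 * (2 * real n + 1) * \<theta> powr (b * real n)"
  let ?u = "\<lambda>n. U n 0 / growth ^ n"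
  have Dpos: "0 < ?D n" for n using g G_1_bounds(1) by simp
  have \<delta>: "?\<delta> \<longlonglongrightarrow> 0"
  proof (rule tendsto_0_bound)
    show "(\<lambda>n. 3 * err_const / (1 - p)\<^sup>2 * ?P n) \<longlonglongrightarrow> 0"
      unfolding \<theta>_def by (rule exp_decay_tendsto[OF b])
    show "\<forall>\<^sub>F n in sequentially. \<bar>?\<delta> n\<bar> \<le> 3 * err_const / (1 - p)\<^sup>2 * ?P n"
      using q
    proof eventually_elim
      case (elim n)
      have ec: "0 \<le> err_const" using M_nonneg by (simp add: err_const_def)
      have "\<bar>?\<delta> n\<bar> \<le> (real n + 1) * (err_const * (4 * growth) ^ n * (2 * \<theta> ^ q n + \<theta> ^ ?r n)) / ?D n"
        unfolding abs_divide abs_of_pos[OF Dpos] \<theta>_def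
        using Z_star_bound[of "q n" n] elim less_imp_le[OF Dpos] by (intro divide_right_mono) blast+
      also have "\<dots> = (real n + 1) * err_const * (2 * \<theta> ^ q n + \<theta> ^ ?r n) * (4 ^ n / G n 1)"
        using g by (simp add: power_mult_distrib)
      also have "\<dots> \<le> (real n + 1) * err_const * (2 * \<theta> powr (b * real n) + \<theta> powr (b * real n)) *
          ((2 * real n + 1) * (real n + 1) / (1 - p)\<^sup>2)"
        using elim ec \<theta> G_1_bounds(1)[of n]
        by (intro mult_mono add_mono G_1_bounds(2) pow order.refl) auto
      also have "\<dots> = 3 * err_const / (1 - p)\<^sup>2 * ?P n"
        by (simp add: power2_eq_square mult_ac)
      finally show ?case .
    qed
  qed
  have \<delta>': "(\<lambda>n. err n 1 / ?D n) \<longlonglongrightarrow> 0"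
  proof (rule tendsto_0_bound)
    show "(\<lambda>n. 4 * M / (1 - p)\<^sup>2 * ?P n) \<longlonglongrightarrow> 0"
      unfolding \<theta>_def by (rule exp_decay_tendsto[OF b])
    show "\<forall>\<^sub>F n in sequentially. \<bar>err n 1 / ?D n\<bar> \<le> 4 * M / (1 - p)\<^sup>2 * ?P n"
      using q
    proof eventually_elim
      case (elim n)
      have "\<bar>err n 1 / ?D n\<bar> \<le> 4 * M * 16 ^ n / ?D n"
        using err_bound[of n 1] Dpos[of n] by (simp add: abs_divide divide_right_mono)
      also have "\<dots> = 4 * M * \<theta> ^ n * (4 ^ n / G n 1)"
      proof -
        have "(16 :: real) ^ n = 4 ^ n * 4 ^ n" by (simp flip: power_mult_distrib)
        then show ?thesis by (simp add: \<theta>_def power_divide)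
      qed
      also have "\<dots> \<le> 4 * M * \<theta> powr (b * real n) * ((2 * real n + 1) * (real n + 1) / (1 - p)\<^sup>2)"
        using elim M_nonneg \<theta> G_1_bounds(1)[of n]
        by (intro mult_mono G_1_bounds(2) pow order.refl) auto
      \<comment> \<open>The explicit factor \<open>1\<close> is next enlarged to
        \<open>real n + 1\<close>, so that the decaying bound \<open>?P\<close> serves here
        too.\<close>
      also have "\<dots> = 4 * M / (1 - p)\<^sup>2 * (1 * (real n + 1) * (2 * real n + 1) * \<theta> powr (b * real n))"
        by (simp add: mult_ac)
      also have "\<dots> \<le> 4 * M / (1 - p)\<^sup>2 * ?P n"
        using M_nonneg unfolding power2_eq_square by (intro mult_left_mono mult_right_mono) auto
      finally show ?case .
    qed
  qed
  have S: "(\<lambda>n. ?S n / G n 1) \<longlonglongrightarrow> 1"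
  proof -
    have "(\<lambda>n. ?S n / G n 1 - 1) \<longlonglongrightarrow> 0"
    proof (rule tendsto_0_bound)
      show "(\<lambda>n. (1 + p)\<^sup>2 * ground_norm * (catalan (q n) * catalan (?r n) / G n 1)) \<longlonglongrightarrow> 0"
        by (rule tendsto_mult_right_zero[OF catalan_product_tendsto[OF b q]])
      show "\<forall>\<^sub>F n in sequentially. \<bar>?S n / G n 1 - 1\<bar> \<le>
          (1 + p)\<^sup>2 * ground_norm * (catalan (q n) * catalan (?r n) / G n 1)"
        using q
      proof eventually_elim
        case (elim n)
        have "\<bar>?S n / G n 1 - 1\<bar> = \<bar>?S n - G n 1\<bar> / G n 1"
          using G_1_bounds(1)[of n] by (simp add: diff_divide_distrib[symmetric] abs_divide divide_diff_eq_iff)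
        also have "\<dots> \<le> (1 + p)\<^sup>2 * ground_norm * (catalan (q n) * catalan (?r n)) / G n 1"
          using G_1_bounds(1)[of n] elim by (intro divide_right_mono sum_G_G) auto
        finally show ?case by simp
      qed
    qed
    then show ?thesis by (simp add: LIM_zero_iff)
  qed
  have lim: "filterlim f at_top sequentially" if "eventually (\<lambda>n. b * real n \<le> real (f n)) sequentially"
    for f :: "nat \<Rightarrow> nat"
  proof -
    have "filterlim (\<lambda>n. b * real n) at_top sequentially" using b by real_asymp
    then have "filterlim (\<lambda>n. real (f n)) at_top sequentially"
      using that by (rule filterlim_at_top_mono)
    then show ?thesis by (simp add: filterlim_sequentially_iff_filterlim_real)
  qed
  have uq: "(\<lambda>n. ?u (q n)) \<longlonglongrightarrow> 1 - p"
    by (rule filterlim_compose[OF U_0_tendsto lim]) (use q in eventually_elim, blast)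
  have ur: "(\<lambda>n. ?u (?r n)) \<longlonglongrightarrow> 1 - p"
    by (rule filterlim_compose[OF U_0_tendsto lim]) (use q in eventually_elim, blast)
  have "(\<lambda>n. (?u (q n) * ?u (?r n) * (?S n / G n 1) + ?\<delta> n) / (?u n + err n 1 / ?D n)) \<longlonglongrightarrow>
      ((1 - p) * (1 - p) * 1 + 0) / ((1 - p) + 0)"
    using p_less_1 by (intro tendsto_intros uq ur S \<delta> \<delta>' U_0_tendsto) auto
  moreover have "\<forall>\<^sub>F n in sequentially.
      (?u (q n) * ?u (?r n) * (?S n / G n 1) + ?\<delta> n) / (?u n + err n 1 / ?D n) = Z_star n z (q n) / C n z 0"
    using q
  proof eventually_elim
    case (elim n)
    have gn: "growth ^ n = growth ^ q n * growth ^ ?r n" using elim by (simp flip: power_add)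
    have num: "?u (q n) * ?u (?r n) * (?S n / G n 1) + ?\<delta> n = Z_star n z (q n) / ?D n"
      unfolding gn diff_divide_distrib by simp
    have "?u n = U n 0 * G n 1 / ?D n" using G_1_bounds(1)[of n] by simp
    then have den: "?u n + err n 1 / ?D n = C n z 0 / ?D n"
      by (simp add: C_eq add_divide_distrib)
    show ?case unfolding num den using g G_1_bounds(1)[of n] by simp
  qed
  ultimately show ?thesis
    using p_less_1 by (simp add: Lim_transform_eventually)
qed

end

theorem mainTheorem8:
  fixes a z :: real
  assumes "0 < a" and "a < 1" and "2 < z"
  shows "(\<lambda>n. pressure n z (2 * nat \<lfloor>a * real n / 2\<rfloor>)) \<longlonglongrightarrow> - ln (z - 1)"
proof -
  interpret adsorbed z by unfold_locales (rule assms)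
  let ?q = "\<lambda>n. 2 * nat \<lfloor>a * real n / 2\<rfloor>"
  \<comment> \<open>\<open>1 - a\<close> controls the right segment. Halving \<open>a\<close> pays
    for the rounding, which costs at most \<open>2\<close>, once
    \<open>4 \<le> a * real n\<close>.\<close>
  define b where "b = min (a / 2) (1 - a)"
  have b: "0 < b" using assms by (simp add: b_def)
  have b2: "b \<le> a / 2" "b \<le> 1 - a" unfolding b_def by (rule min.cobounded1, rule min.cobounded2)
  have "\<forall>\<^sub>F n in sequentially. 4 / a \<le> real n"
    by real_asymp
  then have "\<forall>\<^sub>F n in sequentially. ?q n \<le> n \<and> b * real n \<le> real (?q n) \<and> b * real n \<le> real (n - ?q n)"
  proof eventually_elim
    case (elim n)
    have "0 \<le> a * real n / 2" using assms by simp
    then have f: "real (?q n) = 2 * of_int \<lfloor>a * real n / 2\<rfloor>" by simp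
    have up: "real (?q n) \<le> a * real n" and lo: "a * real n - 2 \<le> real (?q n)"
      unfolding f by linarith+
    have "a * real n \<le> 1 * real n" using assms by (intro mult_right_mono) auto
    then have le: "?q n \<le> n" using up by linarith
    have "4 \<le> a * real n" using elim assms by (simp add: field_simps)
    moreover have "b * real n \<le> a / 2 * real n" using b2 by (intro mult_right_mono) auto
    ultimately have "b * real n \<le> real (?q n)" using lo by linarith
    moreover have "b * real n \<le> (1 - a) * real n" using b2 by (intro mult_right_mono) auto
    then have "b * real n \<le> real n - real (?q n)" using up by (simp add: left_diff_distrib)
    ultimately show ?case using le by (simp only: of_nat_diff)
  qed
  from ratio_tendsto[OF b this]
  have "(\<lambda>n. 1 - Z_star n z (?q n) / C n z 0) \<longlonglongrightarrow> 1 - (1 - p)"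
    by (intro tendsto_intros)
  \<comment> \<open>The limit is \<open>p\<close>, which is positive, so \<open>ln\<close> is
    continuous there.\<close>
  then have "(\<lambda>n. ln (1 - Z_star n z (?q n) / C n z 0)) \<longlonglongrightarrow> ln (1 - (1 - p))"
    using p_pos by (intro tendsto_ln) auto
  also have "ln (1 - (1 - p)) = - ln (z - 1)"
    using assms by (simp add: p_def ln_div)
  finally show ?thesis by (simp add: pressure_def)
qed

end
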